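(* Let $T>0$, $V>0$ and $\alpha_1,\alpha_2\ge0$ with $\alpha_1+\alpha_2=1$. For problem (P1) below, the hover-fly-hover (HFH) trajectory is optimal: there exist $-D/2\le x_{\rm I}\le x_{\rm F}\le D/2$ and $t_{\rm I},t_{\rm F}\ge0$ with $t_{\rm I}+(x_{\rm F}-x_{\rm I})/V+t_{\rm F}=T$ such that the trajectory $x(t)=x_{\rm I}$ for $t\in[0,t_{\rm I}]$, $x(t)=x_{\rm I}+(t-t_{\rm I})V$ for $t\in(t_{\rm I},T-t_{\rm F})$, $x(t)=x_{\rm F}$ for $t\in[T-t_{\rm F},T]$, together with a suitable power allocation, is optimal for (P1). Problem (P1): maximize $r$ over $(r,r_1,r_2,x,p_1,p_2)$ subject to $r_k\ge\alpha_kr$ ($k=1,2$), $(r_1,r_2)\in\mathcal{C}(x,p)$, $p_1(t)+p_2(t)\le\bar P$, $p_k(t)\ge0$, $|\dot x(t)|\le V$ for all $t\in[0,T]$.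
   Context: Fix $D>0$, $H>0$, $\beta_0>0$, $\bar P>0$. Ground users GU 1, GU 2 are at $x_1=-D/2$, $x_2=D/2$; for UAV horizontal position $x$ (altitude $H$), $h_k(x)=\beta_0/((x-x_k)^2+H^2)$. Trajectories are functions $x:[0,T]\to\mathbb{R}$, power allocations are measurable $p_1,p_2:[0,T]\to[0,\infty)$. $\mathcal{C}(x,p)$ is the set of $(r_1,r_2)$, $r_1,r_2\ge0$, with $r_1\le\frac1T\int_0^T\log_2(1+p_1(t)h_1(x(t)))dt$, $r_2\le\frac1T\int_0^T\log_2(1+p_2(t)h_2(x(t)))dt$, $r_1+r_2\le\frac1T\int_0^T\log_2(1+p_1(t)h_1(x(t))+p_2(t)h_2(x(t)))dt$. *)

theory Defs
  imports "HOL-Analysis.Analysis"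
begin

text \<open>Channel power gain from a UAV at horizontal position x (altitude H) to a
  ground user located at xk.  GU 1 is at -D/2, GU 2 at D/2.\<close>
definition chan_gain :: "real \<Rightarrow> real \<Rightarrow> real \<Rightarrow> real \<Rightarrow> real" where
  "chan_gain beta0 H xk x = beta0 / ((x - xk)^2 + H^2)"

definition h1 :: "real \<Rightarrow> real \<Rightarrow> real \<Rightarrow> real \<Rightarrow> real" where
  "h1 beta0 H D x = chan_gain beta0 H (- D / 2) x"

definition h2 :: "real \<Rightarrow> real \<Rightarrow> real \<Rightarrow> real \<Rightarrow> real" where
  "h2 beta0 H D x = chan_gain beta0 H (D / 2) x"

definition rate_region ::
  "real \<Rightarrow> real \<Rightarrow> real \<Rightarrow> real \<Rightarrow> (real \<Rightarrow> real) \<Rightarrow> (real \<Rightarrow> real) \<Rightarrow> (real \<Rightarrow> real)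
    \<Rightarrow> (real \<times> real) set" where
  "rate_region beta0 H D T x p1 p2 =
     {(r1, r2). r1 \<ge> 0 \<and> r2 \<ge> 0 \<and>
       r1 \<le> (1 / T) * set_lebesgue_integral lborel {0..T}
               (\<lambda>t. log 2 (1 + p1 t * h1 beta0 H D (x t))) \<and>
       r2 \<le> (1 / T) * set_lebesgue_integral lborel {0..T}
               (\<lambda>t. log 2 (1 + p2 t * h2 beta0 H D (x t))) \<and>
       r1 + r2 \<le> (1 / T) * set_lebesgue_integral lborel {0..T}
               (\<lambda>t. log 2 (1 + p1 t * h1 beta0 H D (x t) + p2 t * h2 beta0 H D (x t)))}"

text \<open>Feasibility for problem (P1).  The speed constraint |x'(t)| \<le> V is read as
  V-Lipschitz continuity of the trajectory on [0,T] (the HFH trajectory itself is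
  not differentiable at its corners).\<close>
definition P1_feasible ::
  "real \<Rightarrow> real \<Rightarrow> real \<Rightarrow> real \<Rightarrow> real \<Rightarrow> real \<Rightarrow> real \<Rightarrow> real \<Rightarrow>
   real \<Rightarrow> real \<Rightarrow> real \<Rightarrow> (real \<Rightarrow> real) \<Rightarrow> (real \<Rightarrow> real) \<Rightarrow> (real \<Rightarrow> real) \<Rightarrow> bool" where
  "P1_feasible beta0 H D Pbar T V a1 a2 r r1 r2 x p1 p2 \<longleftrightarrow>
     r1 \<ge> a1 * r \<and> r2 \<ge> a2 * r \<and>
     (r1, r2) \<in> rate_region beta0 H D T x p1 p2 \<and>
     p1 \<in> borel_measurable (restrict_space lborel {0..T}) \<and>
     p2 \<in> borel_measurable (restrict_space lborel {0..T}) \<and>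
     (\<forall>t\<in>{0..T}. p1 t \<ge> 0 \<and> p2 t \<ge> 0 \<and> p1 t + p2 t \<le> Pbar) \<and>
     (\<forall>s\<in>{0..T}. \<forall>t\<in>{0..T}. \<bar>x s - x t\<bar> \<le> V * \<bar>s - t\<bar>)"

definition P1_optimal ::
  "real \<Rightarrow> real \<Rightarrow> real \<Rightarrow> real \<Rightarrow> real \<Rightarrow> real \<Rightarrow> real \<Rightarrow> real \<Rightarrow>
   real \<Rightarrow> real \<Rightarrow> real \<Rightarrow> (real \<Rightarrow> real) \<Rightarrow> (real \<Rightarrow> real) \<Rightarrow> (real \<Rightarrow> real) \<Rightarrow> bool" where
  "P1_optimal beta0 H D Pbar T V a1 a2 r r1 r2 x p1 p2 \<longleftrightarrow>
     P1_feasible beta0 H D Pbar T V a1 a2 r r1 r2 x p1 p2 \<and>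
     (\<forall>r' r1' r2' x' p1' p2'.
        P1_feasible beta0 H D Pbar T V a1 a2 r' r1' r2' x' p1' p2' \<longrightarrow> r' \<le> r)"

definition hfh_traj :: "real \<Rightarrow> real \<Rightarrow> real \<Rightarrow> real \<Rightarrow> real \<Rightarrow> real \<Rightarrow> real \<Rightarrow> real" where
  "hfh_traj T V xI xF tI tF t =
     (if t \<le> tI then xI
      else if t < T - tF then xI + (t - tI) * V
      else xF)"

end

theory Submission
  imports Defs
begin

text \<open>
  For a weight w in [0,1] let best w x be the largest value of w r1 + (1 - w) r2 over the
  rate pairs that a UAV hovering at x can serve.  A V-Lipschitz trajectory whose range is
  [a,b] spends at least (1/V) dy above each dy in [a,b], so its weighted rate is at most what
  one obtains by crossing [a,b] once at full speed and spending the remaining time at a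
  maximizer of best w over [a,b].  These inequalities, one for each w, bound r; the pairs
  ([a,b], r) that satisfy all of them form a compact set, so there is one with r largest.

  For that [a,b] a hover-fly-hover trajectory attains r.  The weights for which some maximizer
  (position and power) favours user 1, respectively user 2, relative to the ratio a1 : a2 form
  two nonempty closed sets covering [0,1], so a single weight has maximizers c1 and c2 of both kinds.
  Take the long trajectory that hovers at c1 for time T, flies to c2 and hovers there for time T,
  always with a w-optimal power.  Each of its windows of length T is a hover-fly-hover
  trajectory.  As the window slides, the imbalance a2 r1 - a1 r2 changes sign, so it vanishes
  for some window.  That window flies only inside [a,b] and otherwise hovers at maximizers, so
  its weighted rate is at least the upper bound.
\<close>

section \<open>Maxima over compact sets and integrals\<close>

lemma SUP_compact:
  fixes g :: "'a::topological_space \<Rightarrow> real"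
  assumes "compact L" "L \<noteq> {}" "continuous_on L g"
  shows SUP_compact_attained: "\<exists>y\<in>L. g y = (SUP y\<in>L. g y)"
    and SUP_compact_upper: "y \<in> L \<Longrightarrow> g y \<le> (SUP y\<in>L. g y)"
proof -
  obtain y0 where y0: "y0 \<in> L" "\<And>y. y \<in> L \<Longrightarrow> g y \<le> g y0"
    using continuous_attains_sup[OF assms] by blast
  have "(SUP y\<in>L. g y) = g y0"
    by (intro cSup_eq_maximum) (use y0 in auto)
  then show "\<exists>y\<in>L. g y = (SUP y\<in>L. g y)" "y \<in> L \<Longrightarrow> g y \<le> (SUP y\<in>L. g y)"
    using y0 by auto
qed

text \<open>Compactness of \<open>L\<close> makes \<open>f x\<close> uniformly close to
  \<open>f x0\<close> on \<open>L\<close> for \<open>x\<close> near \<open>x0\<close>. Evaluating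
  each of the two functions at the other's maximizer then shows that their maxima are equally
  close.\<close>

lemma continuous_on_SUP_compact:
  fixes f :: "'a::t2_space \<Rightarrow> 'b::topological_space \<Rightarrow> real"
  assumes L: "compact L" "L \<noteq> {}" and f: "continuous_on UNIV (\<lambda>(x, y). f x y)"
  shows "continuous_on UNIV (\<lambda>x. SUP y\<in>L. f x y)"
proof -
  have fx: "continuous_on L (f x)" for x
    by (rule continuous_on_compose2[OF f, of L "\<lambda>y. (x, y)", simplified]) (auto intro!: continuous_intros)
  have "isCont (\<lambda>x. SUP y\<in>L. f x y) x0" for x0
  proof (unfold continuous_at tendsto_iff, intro allI impI)
    fix e :: real assume "e > 0"
    obtain X0 where X0: "x0 \<in> X0" "open X0"
      and close: "\<forall>x\<in>X0 \<inter> UNIV. \<forall>t\<in>L. dist (case (x, t) of (x, y) \<Rightarrow> f x y) (case (x0, t) of (x, y) \<Rightarrow> f x y) \<le> e / 2"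
      using continuous_on_prod_compactE[OF continuous_on_subset[OF f] L(1), of UNIV x0 "e / 2"] \<open>e > 0\<close>
      by auto
    have "dist (SUP y\<in>L. f x y) (SUP y\<in>L. f x0 y) < e" if x: "x \<in> X0" for x
    proof -
      obtain y y0 where y: "y \<in> L" "f x y = (SUP y\<in>L. f x y)" and y0: "y0 \<in> L" "f x0 y0 = (SUP y\<in>L. f x0 y)"
        using SUP_compact_attained[OF L fx] by metis
      have "f x y0 \<le> (SUP y\<in>L. f x y)" "f x0 y \<le> (SUP y\<in>L. f x0 y)"
        using SUP_compact_upper[OF L fx] y y0 by auto
      moreover have "\<bar>f x y - f x0 y\<bar> \<le> e / 2" "\<bar>f x y0 - f x0 y0\<bar> \<le> e / 2"
        using close x y(1) y0(1) by (auto simp: dist_real_def)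
      ultimately show ?thesis using y y0 \<open>e > 0\<close> unfolding dist_real_def by argo
    qed
    then show "\<forall>\<^sub>F x in at x0. dist (SUP y\<in>L. f x y) (SUP y\<in>L. f x0 y) < e"
      using X0 by (auto simp: eventually_at_topological)
  qed
  then show ?thesis by (simp add: continuous_at_imp_continuous_on)
qed

text \<open>The smallest maximizer is selected. Its sublevel sets are projections, along a compact
  interval, of the closed set where \<open>f\<close> equals its maximum. They are therefore closed,
  and the selection is Borel.\<close>

lemma measurable_argmax:
  fixes f :: "real \<Rightarrow> real \<Rightarrow> real"
  assumes ab: "a \<le> b" and f: "continuous_on UNIV (\<lambda>(x, y). f x y)"
  obtains m where "m \<in> borel_measurable borel"
    and "\<And>x. m x \<in> {a..b}" and "\<And>x. f x (m x) = (SUP y\<in>{a..b}. f x y)"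
proof -
  define F where "F x = (SUP y\<in>{a..b}. f x y)" for x
  have L: "compact {a..b}" "{a..b} \<noteq> {}" using ab by auto
  have fx: "continuous_on S (f x)" for x S
    by (rule continuous_on_compose2[OF f, of S "\<lambda>y. (x, y)", simplified]) (auto intro!: continuous_intros)
  have Fc: "continuous_on UNIV F"
    unfolding F_def by (rule continuous_on_SUP_compact[OF L f])
  define A where "A x = {y \<in> {a..b}. f x y = F x}" for x
  have A_ne: "A x \<noteq> {}" for x
    using SUP_compact_attained[OF L fx, of x] unfolding A_def F_def by auto
  have A_bdd: "bdd_below (A x)" for x unfolding A_def by (auto intro!: bdd_belowI)
  have "closed (A x)" for x
  proof -
    have "A x = {a..b} \<inter> {y. f x y = F x}" unfolding A_def by auto
    then show ?thesis by (auto intro!: closed_Int closed_Collect_eq fx continuous_intros)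
  qed
  then have m: "Inf (A x) \<in> A x" for x
    using closed_contains_Inf[OF A_ne A_bdd] by auto
  have "closed {x. Inf (A x) \<le> c}" for c
  proof -
    have "{x. Inf (A x) \<le> c} = {x. \<exists>y. y \<in> {a..min b c} \<and> (y, x) \<in> {z. f (snd z) (fst z) = F (snd z)}}"
    proof (intro Collect_cong iffI)
      fix x assume "Inf (A x) \<le> c"
      then show "\<exists>y. y \<in> {a..min b c} \<and> (y, x) \<in> {z. f (snd z) (fst z) = F (snd z)}"
        using m[of x] by (intro exI[of _ "Inf (A x)"]) (auto simp: A_def)
    next
      fix x assume "\<exists>y. y \<in> {a..min b c} \<and> (y, x) \<in> {z. f (snd z) (fst z) = F (snd z)}"
      then obtain y where "y \<in> A x" "y \<le> c" by (auto simp: A_def)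
      then show "Inf (A x) \<le> c" using cInf_lower[OF _ A_bdd] by fastforce
    qed
    moreover have "closed {z. f (snd z) (fst z) = F (snd z)}"
      by (intro closed_Collect_eq continuous_on_compose2[OF f, of _ "\<lambda>z. (snd z, fst z)", simplified] continuous_on_compose2[OF Fc])
         (auto intro!: continuous_intros)
    ultimately show ?thesis
      using closed_compact_projection[of "{a..min b c}" "{z. f (snd z) (fst z) = F (snd z)}"] by auto
  qed
  then have "(\<lambda>x. Inf (A x)) \<in> borel_measurable borel"
    by (subst borel_measurable_iff_le) auto
  with m show ?thesis by (intro that[of "\<lambda>x. Inf (A x)"]) (auto simp: A_def F_def)
qed

lemma bounded_borel_integral:
  fixes f :: "real \<Rightarrow> real"
  assumes "f \<in> borel_measurable borel" "\<And>t. t \<in> {a..b} \<Longrightarrow> \<bar>f t\<bar> \<le> B"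
  shows "set_integrable lborel {a..b} f" "f integrable_on {a..b}"
    "set_lebesgue_integral lborel {a..b} f = integral {a..b} f"
proof -
  show "set_integrable lborel {a..b} f"
    unfolding set_integrable_def
    by (rule integrableI_bounded_set[where A="{a..b}" and B=B])
       (use assms in \<open>auto simp: indicator_def emeasure_lborel_Icc_eq\<close>)
  then show "f integrable_on {a..b}" "set_lebesgue_integral lborel {a..b} f = integral {a..b} f"
    using set_borel_integral_eq_integral by auto
qed

lemma set_integrable_bounded_restrict:
  fixes f :: "real \<Rightarrow> real"
  assumes "f \<in> borel_measurable (restrict_space lborel {a..b})" "\<And>t. t \<in> {a..b} \<Longrightarrow> \<bar>f t\<bar> \<le> B"
  shows "set_integrable lborel {a..b} f"
proof -
  have "(\<lambda>t. indicator {a..b} t *\<^sub>R f t) \<in> borel_measurable lborel"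
    using assms(1) by (subst (asm) borel_measurable_restrict_space_iff) auto
  then show ?thesis unfolding set_integrable_def
    by (intro integrableI_bounded_set[where A="{a..b}" and B=B])
       (use assms(2) in \<open>auto simp: indicator_def emeasure_lborel_Icc_eq\<close>)
qed

lemma integral_subset_le_nonneg:
  fixes f :: "real \<Rightarrow> real"
  assumes "{u..v} \<subseteq> {a..b}" "f integrable_on {a..b}" "\<And>t. t \<in> {a..b} \<Longrightarrow> 0 \<le> f t"
  shows "integral {u..v} f \<le> integral {a..b} f"
  by (rule integral_subset_le) (use assms integrable_on_subinterval[OF assms(2,1)] in auto)

lemma window_integral_continuous:
  fixes f :: "real \<Rightarrow> real"
  assumes f: "\<And>u v. f integrable_on {u..v}" and T: "0 \<le> T"
  shows "continuous_on {0..S} (\<lambda>\<tau>. integral {\<tau>..\<tau> + T} f)"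
proof -
  define J where "J t = integral {0..t} f" for t
  have J: "continuous_on {0..S + T} J"
    unfolding J_def[abs_def] by (rule indefinite_integral_continuous_1[OF f])
  have "continuous_on {0..S} (\<lambda>\<tau>. J (\<tau> + T))"
    by (rule continuous_on_compose2[OF J, of _ "\<lambda>\<tau>. \<tau> + T"]) (use T in \<open>auto intro!: continuous_intros\<close>)
  moreover have "continuous_on {0..S} J"
    by (rule continuous_on_subset[OF J]) (use T in auto)
  ultimately have "continuous_on {0..S} (\<lambda>\<tau>. J (\<tau> + T) - J \<tau>)"
    by (rule continuous_on_diff)
  moreover have "J (\<tau> + T) - J \<tau> = integral {\<tau>..\<tau> + T} f" if "\<tau> \<in> {0..S}" for \<tau>
    using Henstock_Kurzweil_Integration.integral_combine[of 0 \<tau> "\<tau> + T" f] that T f by (simp add: J_def)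
  ultimately show ?thesis by (rule continuous_on_eq)
qed

section \<open>Occupation time of Lipschitz trajectories\<close>

text \<open>A trajectory of speed at most \<open>V\<close> spends time at least
  \<open>dy / V\<close> above each \<open>dy\<close> between its end positions. As \<open>x\<close>
  is merely Lipschitz, no substitution rule is used: the inequality is proved with a small slack on
  short time intervals, where \<open>G\<close> is nearly constant, and these are glued together by
  bisection.\<close>

lemma occupation_integral_ordered:
  fixes x G :: "real \<Rightarrow> real"
  assumes t: "t0 \<le> t1" and V: "V > 0" and lip: "V-lipschitz_on {t0..t1} x"
    and G: "continuous_on UNIV G" "\<And>y. G y \<ge> 0"
    and xle: "x t0 \<le> x t1"
  shows "integral {x t0..x t1} G \<le> V * integral {t0..t1} (\<lambda>t. G (x t))"
proof (rule field_le_epsilon)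
  fix e0 :: real assume e0: "e0 > 0"
  define e where "e = e0 / (t1 - t0 + 1)"
  have e: "e > 0" "e * (t1 - t0) \<le> e0"
    using e0 t by (auto simp: e_def field_simps)
  have Gi: "G integrable_on {u..v}" for u v
    by (rule integrable_continuous_interval) (rule continuous_on_subset[OF G(1)], auto)
  have xV: "\<bar>x s - x s'\<bar> \<le> V * \<bar>s - s'\<bar>" if "s \<in> {t0..t1}" "s' \<in> {t0..t1}" for s s'
    using lipschitz_onD[OF lip that] by (simp add: dist_real_def)
  have xGc: "continuous_on {t0..t1} (\<lambda>t. G (x t))"
    by (rule continuous_on_compose2[OF G(1) lipschitz_on_continuous_on[OF lip]]) auto
  have Gxi: "(\<lambda>t. G (x t)) integrable_on {u..v}" if "t0 \<le> u" "v \<le> t1" for u v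
    by (rule integrable_continuous_interval) (rule continuous_on_subset[OF xGc], use that in auto)
  \<comment> \<open>A position below the whole trajectory serves as base point of an antiderivative
    \<open>Phi\<close> of \<open>G\<close>. Differences of \<open>Phi\<close> are additive along the
    trajectory even where it turns back.\<close>
  define lo where "lo = x t0 - V * (t1 - t0)"
  have lo: "lo \<le> x s" if "s \<in> {t0..t1}" for s
  proof -
    have "x t0 - x s \<le> V * \<bar>t0 - s\<bar>" using xV[of t0 s] that t by auto
    also have "\<dots> \<le> V * (t1 - t0)" using V that by (intro mult_left_mono) auto
    finally show ?thesis by (simp add: lo_def)
  qed
  define Phi where "Phi y = integral {lo..y} G" for y
  have Phi: "Phi y' - Phi y = integral {y..y'} G" if "lo \<le> y" "y \<le> y'" for y y'
    unfolding Phi_def using Henstock_Kurzweil_Integration.integral_combine[OF that Gi] by linarith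
  \<comment> \<open>The slack \<open>e * (v - u)\<close> is additive in time, so concatenation
    preserves \<open>P\<close>. The guard on \<open>u\<close> and \<open>v\<close> is there because
    the short intervals around a point may leave \<open>{t0..t1}\<close>.\<close>
  define P where "P u v \<longleftrightarrow> (t0 \<le> u \<and> v \<le> t1 \<longrightarrow>
    Phi (x v) - Phi (x u) \<le> V * integral {u..v} (\<lambda>t. G (x t)) + e * (v - u))" for u v
  have "P t0 t1"
    using t
  proof (induction rule: Bolzano)
    case (trans a b c)
    show ?case
      unfolding P_def
    proof
      assume "t0 \<le> a \<and> c \<le> t1"
      moreover from this have "integral {a..c} (\<lambda>t. G (x t))
          = integral {a..b} (\<lambda>t. G (x t)) + integral {b..c} (\<lambda>t. G (x t))"
        using Henstock_Kurzweil_Integration.integral_combine[OF trans(3,4) Gxi] by auto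
      ultimately show "Phi (x c) - Phi (x a) \<le> V * integral {a..c} (\<lambda>t. G (x t)) + e * (c - a)"
        using trans by (simp add: P_def algebra_simps)
    qed
  next
    case (local s)
    define g where "g = G (x s)"
    \<comment> \<open>With this choice the upper estimate \<open>(g + e') * (V * (v - u))\<close>
      and the lower estimate \<open>V * ((g - e') * (v - u))\<close> differ by exactly the slack
      \<open>e * (v - u)\<close>.\<close>
    define e' where "e' = e / (2 * V)"
    have "e' > 0" using e V by (auto simp: e'_def)
    then obtain d where d: "d > 0" "\<And>y. \<bar>y - x s\<bar> < d \<Longrightarrow> \<bar>G y - g\<bar> < e'"
      using G(1)[unfolded continuous_on_iff] unfolding g_def dist_real_def by (metis UNIV_I)
    have "Phi (x v) - Phi (x u) \<le> V * integral {u..v} (\<lambda>t. G (x t)) + e * (v - u)"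
      if uv: "u \<le> s" "s \<le> v" "v - u < d / V" "t0 \<le> u" "v \<le> t1" for u v
    proof -
      have near: "\<bar>x r - x s\<bar> < d" if "r \<in> {u..v}" for r
      proof -
        have "\<bar>x r - x s\<bar> \<le> V * \<bar>r - s\<bar>" using xV[of r s] that uv by auto
        also have "\<dots> \<le> V * (v - u)" using V that uv by (intro mult_left_mono) auto
        also have "\<dots> < d" using uv(3) V by (simp add: field_simps)
        finally show ?thesis .
      qed
      have I0: "integral {u..v} (\<lambda>t. G (x t)) \<ge> 0"
        by (rule integral_nonneg) (use G Gxi uv in auto)
      have "(g - e') * (v - u) = integral {u..v} (\<lambda>t. g - e')" using uv by simp
      also have "\<dots> \<le> integral {u..v} (\<lambda>t. G (x t))"
        using near d(2) by (intro integral_le Gxi uv) force+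
      finally have I: "V * ((g - e') * (v - u)) \<le> V * integral {u..v} (\<lambda>t. G (x t))"
        using V by (intro mult_left_mono) auto
      show ?thesis
      proof (cases "x u \<le> x v")
        case True
        have "Phi (x v) - Phi (x u) = integral {x u..x v} G"
          using True lo[of u] uv by (intro Phi) auto
        also have "\<dots> \<le> integral {x u..x v} (\<lambda>y. g + e')"
        proof (intro integral_le Gi)
          fix y assume "y \<in> {x u..x v}"
          then have "\<bar>y - x s\<bar> < d" using near[of u] near[of v] uv by auto
          then show "G y \<le> g + e'" using d(2)[of y] by linarith
        qed auto
        also have "\<dots> = (g + e') * (x v - x u)" using True by simp
        also have "\<dots> \<le> (g + e') * (V * (v - u))"
          using xV[of v u] uv G(2)[of "x s"] \<open>e' > 0\<close> by (intro mult_left_mono) (auto simp: g_def)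
        also have "\<dots> = V * ((g - e') * (v - u)) + e * (v - u)"
          using V by (simp add: e'_def field_simps)
        finally show ?thesis using I by linarith
      next
        case False
        then have "Phi (x u) - Phi (x v) = integral {x v..x u} G"
          using lo[of v] uv by (intro Phi) auto
        also have "\<dots> \<ge> 0" by (rule integral_nonneg) (use G Gi in auto)
        finally have "Phi (x v) - Phi (x u) \<le> 0" by simp
        also have "\<dots> \<le> V * integral {u..v} (\<lambda>t. G (x t)) + e * (v - u)"
          using I0 V e uv by auto
        finally show ?thesis .
      qed
    qed
    then show ?case using d(1) V by (intro exI[of _ "d / V"]) (auto simp: P_def)
  qed
  then show "integral {x t0..x t1} G \<le> V * integral {t0..t1} (\<lambda>t. G (x t)) + e0"
    using Phi[OF lo xle] t e by (auto simp: P_def)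
qed

text \<open>Between the times at which the minimum \<open>a\<close> and the maximum \<open>b\<close>
  are reached the trajectory crosses all of \<open>{a..b}\<close>; the remaining time contributes a
  nonnegative amount.\<close>

lemma occupation_integral:
  fixes x G :: "real \<Rightarrow> real"
  assumes T: "0 \<le> T" and V: "V > 0" and lip: "V-lipschitz_on {0..T} x"
    and G: "continuous_on UNIV G" "\<And>y. y \<in> {a..b} \<Longrightarrow> G y \<ge> 0"
    and range: "x ` {0..T} = {a..b}"
  shows "integral {a..b} G \<le> V * integral {0..T} (\<lambda>t. G (x t))"
proof -
  \<comment> \<open>Truncation gives nonnegativity on the whole line without changing
    \<open>G\<close> on \<open>{a..b}\<close>, where the trajectory stays.\<close>
  define G' where "G' y = max 0 (G y)" for y
  have G': "continuous_on UNIV G'" "\<And>y. G' y \<ge> 0" "\<And>y. y \<in> {a..b} \<Longrightarrow> G' y = G y"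
    using G by (auto simp: G'_def[abs_def] intro!: continuous_intros)
  have ab: "a \<le> b" using range T by (metis atLeastAtMost_iff atLeastatMost_empty_iff image_is_empty)
  then obtain ta tb where ta: "ta \<in> {0..T}" "x ta = a" and tb: "tb \<in> {0..T}" "x tb = b"
    using range by (metis atLeastAtMost_iff imageE order_refl)
  have G'x: "(\<lambda>t. G' (x t)) integrable_on {u..v}" if "0 \<le> u" "v \<le> T" for u v
    by (rule integrable_continuous_interval)
       (rule continuous_on_compose2[OF G'(1) lipschitz_on_continuous_on[OF lipschitz_on_subset[OF lip]]],
         use that in auto)
  have sub: "integral {u..v} (\<lambda>t. G' (x t)) \<le> integral {0..T} (\<lambda>t. G' (x t))" if "0 \<le> u" "v \<le> T" for u v
    by (rule integral_subset_le) (use that G'x G' in auto)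
  have "integral {a..b} G' \<le> V * integral {0..T} (\<lambda>t. G' (x t))"
  proof (cases "ta \<le> tb")
    case True
    have "integral {x ta..x tb} G' \<le> V * integral {ta..tb} (\<lambda>t. G' (x t))"
      by (rule occupation_integral_ordered[OF True V lipschitz_on_subset[OF lip] G'(1,2)])
         (use ta tb ab in auto)
    also have "\<dots> \<le> V * integral {0..T} (\<lambda>t. G' (x t))"
      using V ta tb by (intro mult_left_mono sub) auto
    finally show ?thesis using ta tb by simp
  next
    case False
    \<comment> \<open>The maximum is reached first here; reversing time turns the descent into an
      ascent.\<close>
    have "V-lipschitz_on {- ta..- tb} (\<lambda>t. x (- t))"
    proof (intro lipschitz_onI)
      fix s u assume "s \<in> {- ta..- tb}" "u \<in> {- ta..- tb}"
      then have "dist (x (- s)) (x (- u)) \<le> V * dist (- s) (- u)"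
        using ta tb by (intro lipschitz_onD[OF lip]) auto
      then show "dist (x (- s)) (x (- u)) \<le> V * dist s u"
        by (simp add: dist_real_def abs_minus_commute)
    qed (use V in auto)
    then have "integral {x (- (- ta))..x (- (- tb))} G' \<le> V * integral {- ta..- tb} (\<lambda>t. G' (x (- t)))"
      by (intro occupation_integral_ordered[OF _ V _ G'(1,2)]) (use ta tb ab False in auto)
    also have "integral {- ta..- tb} (\<lambda>t. G' (x (- t))) = integral {tb..ta} (\<lambda>t. G' (x t))"
      using Henstock_Kurzweil_Integration.integral_reflect_real[of ta tb "\<lambda>t. G' (x t)"] by simp
    also have "V * \<dots> \<le> V * integral {0..T} (\<lambda>t. G' (x t))"
      using V ta tb by (intro mult_left_mono sub) auto
    finally show ?thesis using ta tb by simp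
  qed
  moreover have "integral {a..b} G' = integral {a..b} G"
    by (rule integral_cong) (use G' in auto)
  moreover have "integral {0..T} (\<lambda>t. G' (x t)) = integral {0..T} (\<lambda>t. G (x t))"
    by (rule integral_cong) (use G'(3) range in blast)
  ultimately show ?thesis by simp
qed

section \<open>Hover-fly-hover trajectories as windows of a long trajectory\<close>

text \<open>The clamp encodes three phases in one continuous formula: hovering at \<open>c1\<close>
  up to time \<open>T\<close>, a flight to the right of duration \<open>d\<close>, and hovering at
  \<open>c1 + V * d\<close> from time \<open>T + d\<close> on.\<close>

definition long_traj :: "real \<Rightarrow> real \<Rightarrow> real \<Rightarrow> real \<Rightarrow> real \<Rightarrow> real" where
  "long_traj T V c1 d t = c1 + V * max 0 (min d (t - T))"

text \<open>The window of length \<open>T\<close> starting at \<open>tau\<close> meets the first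
  hover for time \<open>max 0 (T - tau)\<close> and the last one, which begins at
  \<open>T + d\<close>, for time \<open>max 0 (tau - d)\<close>. The rest of it is flight at full
  speed.\<close>

lemma long_traj_window:
  fixes T V c1 d tau :: real
  assumes V: "V > 0" and d: "0 \<le> d" "d \<le> T" and tau: "0 \<le> tau" "tau \<le> T + d"
  defines "X \<equiv> long_traj T V c1 d"
  defines "tI \<equiv> max 0 (T - tau)" and "tF \<equiv> max 0 (tau - d)"
  shows "tI + (X (tau + T) - X tau) / V + tF = T"
    and "t \<in> {0..T} \<Longrightarrow> hfh_traj T V (X tau) (X (tau + T)) tI tF t = X (tau + t)"
proof -
  have "(X (tau + T) - X tau) / V = max 0 (min d tau) - max 0 (min d (tau - T))"
    using V by (simp add: X_def long_traj_def field_simps)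
  then show "tI + (X (tau + T) - X tau) / V + tF = T"
    using d tau by (auto simp: tI_def tF_def max_def min_def)
  show "hfh_traj T V (X tau) (X (tau + T)) tI tF t = X (tau + t)" if t: "t \<in> {0..T}"
  proof -
    consider "t \<le> tI" | "t > tI" "t < T - tF" | "t > tI" "t \<ge> T - tF" by linarith
    then show ?thesis
    proof cases
      case 1
      then have "max 0 (min d (tau - T)) = max 0 (min d (tau + t - T))"
        using t d tau by (auto simp: tI_def max_def min_def split: if_splits)
      then show ?thesis using 1 by (simp add: hfh_traj_def X_def long_traj_def)
    next
      case 2
      then have *: "max 0 (min d (tau + t - T)) = max 0 (min d (tau - T)) + (t - tI)"
        using t d tau by (auto simp: tI_def tF_def max_def min_def split: if_splits)
      show ?thesis unfolding X_def long_traj_def * using 2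
        by (simp add: hfh_traj_def algebra_simps)
    next
      case 3
      then have "max 0 (min d tau) = max 0 (min d (tau + t - T))"
        using t d tau by (auto simp: tI_def tF_def max_def min_def split: if_splits)
      then show ?thesis using 3 by (simp add: hfh_traj_def X_def long_traj_def)
    qed
  qed
qed

lemma long_traj_continuous: "continuous_on S (long_traj T V c1 d)"
  unfolding long_traj_def[abs_def] by (intro continuous_intros)

text \<open>Since \<open>G\<close> vanishes at both hover positions, only the flight contributes to
  the integral over the whole long trajectory, and substitution evaluates that contribution. By
  nonnegativity a window collects at most as much.\<close>

lemma long_traj_integral_le:
  assumes V: "V > 0" and T: "0 \<le> T" and d: "0 \<le> d" and tau: "0 \<le> tau" "tau \<le> T + d"
    and G: "continuous_on UNIV G" "\<And>y. y \<in> {c1..c1 + V * d} \<Longrightarrow> (G y :: real) \<ge> 0"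
    and G0: "G c1 = 0" "G (c1 + V * d) = 0"
  shows "V * integral {tau..tau + T} (\<lambda>t. G (long_traj T V c1 d t)) \<le> integral {c1..c1 + V * d} G"
proof -
  let ?X = "long_traj T V c1 d"
  have X: "?X t \<in> {c1..c1 + V * d}" for t
    using V d by (auto simp: long_traj_def)
  have GX: "(\<lambda>t. G (?X t)) integrable_on {u..v}" for u v
    by (intro integrable_continuous_interval continuous_on_compose2[OF G(1) long_traj_continuous]) auto
  have 1: "((\<lambda>t. V * G (?X t)) has_integral 0) {0..T}"
    by (rule has_integral_is_0) (use d G0 in \<open>auto simp: long_traj_def max_def min_def\<close>)
  have "((\<lambda>t. V *\<^sub>R G (c1 + V * (t - T))) has_integral
      integral {c1 + V * (T - T)..c1 + V * (T + d - T)} G) {T..T + d}"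
    using V d by (intro has_integral_substitution[where c = c1 and d = "c1 + V * d"])
      (auto intro!: derivative_eq_intros continuous_on_subset[OF G(1)] mult_left_mono)
  then have "((\<lambda>t. V * G (c1 + V * (t - T))) has_integral integral {c1..c1 + V * d} G) {T..T + d}"
    by simp
  then have 2: "((\<lambda>t. V * G (?X t)) has_integral integral {c1..c1 + V * d} G) {T..T + d}"
    by (rule has_integral_eq[rotated]) (auto simp: long_traj_def)
  have 3: "((\<lambda>t. V * G (?X t)) has_integral 0) {T + d..T + d + T}"
    by (rule has_integral_is_0) (use d G0 in \<open>auto simp: long_traj_def max_def min_def\<close>)
  have *: "integral {0..T + d + T} (\<lambda>t. V * G (?X t)) = (0 + integral {c1..c1 + V * d} G) + 0"
    by (rule integral_unique, rule has_integral_combine[OF _ _ has_integral_combine[OF _ _ 1 2] 3]) (use T d in auto)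
  have "V * integral {tau..tau + T} (\<lambda>t. G (?X t)) = integral {tau..tau + T} (\<lambda>t. V * G (?X t))"
    by simp
  also have "\<dots> \<le> integral {0..T + d + T} (\<lambda>t. V * G (?X t))"
    by (rule integral_subset_le_nonneg) (use tau GX G(2)[OF X] V in auto)
  also have "\<dots> = integral {c1..c1 + V * d} G" using * by simp
  finally show ?thesis .
qed

text \<open>Here the first hover lasts \<open>tI\<close> instead of \<open>T\<close>. Continuity and
  the speed bound of a hover-fly-hover trajectory are read off from this formula.\<close>

lemma hfh_traj_eq_long_traj:
  assumes "V > 0" "xI \<le> xF" "tI + (xF - xI) / V + tF = T"
  shows "hfh_traj T V xI xF tI tF = long_traj tI V xI ((xF - xI) / V)"
proof
  fix t
  define d where "d = (xF - xI) / V"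
  have d: "d \<ge> 0" "xF = xI + V * d" "T - tF = tI + d" using assms by (auto simp: d_def)
  show "hfh_traj T V xI xF tI tF t = long_traj tI V xI ((xF - xI) / V) t"
    unfolding d_def[symmetric] hfh_traj_def long_traj_def d(2,3) using d(1)
    by (auto simp: max_def min_def)
qed

lemma long_traj_lipschitz:
  assumes "V > 0"
  shows "\<bar>long_traj T V c1 d s - long_traj T V c1 d t\<bar> \<le> V * \<bar>s - t\<bar>"
proof -
  have "V * \<bar>max 0 (min d (s - T)) - max 0 (min d (t - T))\<bar> \<le> V * \<bar>s - t\<bar>"
    using assms by (intro mult_left_mono) (auto simp: max_def min_def)
  then show ?thesis using assms by (simp add: long_traj_def abs_mult flip: right_diff_distrib)
qed

section \<open>Weighted rates and their multipliers\<close>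

text \<open>
  The pair (R1 x s, R2 x s), for s in [0,2], runs through candidate rate pairs at position x:
  it starts at all power for user 2 (s = 0) and passes through all power for user 1 (s = 1).
\<close>

locale rate_loop =
  fixes R1 R2 :: "real \<Rightarrow> real \<Rightarrow> real"
  assumes R1_cont: "continuous_on UNIV (\<lambda>(x, s). R1 x s)"
    and R2_cont: "continuous_on UNIV (\<lambda>(x, s). R2 x s)"
    and R1_0: "R1 x 0 = 0" and R2_0: "R2 x 0 > 0" and R2_le: "R2 x s \<le> R2 x 0"
    and R2_1: "R2 x 1 = 0" and R1_1: "R1 x 1 > 0" and R1_le: "R1 x s \<le> R1 x 1"
begin

definition obj :: "real \<Rightarrow> real \<Rightarrow> real \<Rightarrow> real" where
  "obj w x s = w * R1 x s + (1 - w) * R2 x s"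

definition best :: "real \<Rightarrow> real \<Rightarrow> real" where
  "best w x = (SUP s\<in>{0..2}. obj w x s)"

lemma R1_cont' [continuous_intros]:
  assumes "continuous_on S f" "continuous_on S g"
  shows "continuous_on S (\<lambda>z. R1 (f z) (g z))"
  by (rule continuous_on_compose2[OF R1_cont, of S "\<lambda>z. (f z, g z)", simplified])
     (intro continuous_intros assms)

lemma R2_cont' [continuous_intros]:
  assumes "continuous_on S f" "continuous_on S g"
  shows "continuous_on S (\<lambda>z. R2 (f z) (g z))"
  by (rule continuous_on_compose2[OF R2_cont, of S "\<lambda>z. (f z, g z)", simplified])
     (intro continuous_intros assms)

lemma obj_cont [continuous_intros]:
  assumes "continuous_on S f" "continuous_on S g" "continuous_on S h"
  shows "continuous_on S (\<lambda>z. obj (f z) (g z) (h z))"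
  unfolding obj_def by (intro continuous_intros assms)

lemma best_attained: "\<exists>s\<in>{0..2}. obj w x s = best w x"
  unfolding best_def by (rule SUP_compact_attained) (auto intro!: continuous_intros)

lemma best_upper: "s \<in> {0..2} \<Longrightarrow> obj w x s \<le> best w x"
  unfolding best_def by (rule SUP_compact_upper) (auto intro!: continuous_intros)

lemma best_cont: "continuous_on UNIV (best w)"
  unfolding best_def[abs_def] split_beta
  by (rule continuous_on_SUP_compact) (auto simp: split_beta intro!: continuous_intros)

lemma best_integrable: "best w integrable_on {a..b}"
  by (rule integrable_continuous_interval) (rule continuous_on_subset[OF best_cont], auto)

text \<open>A point of the loop that serves a single user already has positive weighted rate:
  \<open>s = 0\<close> if \<open>w = 0\<close>, and \<open>s = 1\<close> otherwise.\<close>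

lemma best_pos:
  assumes "0 \<le> w" "w \<le> 1"
  shows "best w x > 0"
proof (cases "w = 0")
  case True
  then show ?thesis using best_upper[of 0 w x] R2_0[of x] by (simp add: obj_def)
next
  case False
  then have "w * R1 x 1 > 0" using assms R1_1[of x] by simp
  then show ?thesis using best_upper[of 1 w x] R2_1[of x] by (simp add: obj_def)
qed

section \<open>Weights with maximizers favouring either user\<close>

lemma closed_maximizer_weights:
  assumes "continuous_on UNIV (\<lambda>(c, s). g c s)"
  shows "closed {w. \<exists>c\<in>{a..b}. \<exists>s\<in>{0..2}.
    (\<forall>y\<in>{a..b}. \<forall>u\<in>{0..2}. obj w y u \<le> obj w c s) \<and> (0::real) \<le> g c s}"
    (is "closed ?N")
proof -
  define Q where "Q = {p :: (real \<times> real) \<times> real. (\<forall>y\<in>{a..b}. \<forall>u\<in>{0..2}.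
      obj (snd p) y u \<le> obj (snd p) (fst (fst p)) (snd (fst p))) \<and> 0 \<le> g (fst (fst p)) (snd (fst p))}"
  have "continuous_on UNIV (\<lambda>p :: (real \<times> real) \<times> real. g (fst (fst p)) (snd (fst p)))"
    by (rule continuous_on_compose2[OF assms, of _ fst, simplified split_beta]) (auto intro!: continuous_intros)
  then have "closed Q"
    unfolding Q_def Ball_def
    by (intro closed_Collect_conj closed_Collect_all closed_Collect_imp closed_Collect_le)
       (auto intro!: continuous_intros)
  \<comment> \<open>Being a maximizer with the given sign is a closed condition on
    \<open>((c, s), w)\<close>; projecting along the compact box of pairs \<open>(c, s)\<close>
    keeps it closed.\<close>
  then have "closed {w. \<exists>z. z \<in> {a..b} \<times> {0..2} \<and> (z, w) \<in> Q}"
    by (intro closed_compact_projection compact_Times) auto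
  also have "{w. \<exists>z. z \<in> {a..b} \<times> {0..2} \<and> (z, w) \<in> Q} = ?N"
    by (auto simp: Q_def simp del: atLeastAtMost_iff)
  finally show ?thesis .
qed

text \<open>The weights with a maximizer where the imbalance \<open>g\<close> is nonnegative, and
  those with one where it is nonpositive, form two closed sets covering \<open>{0..1}\<close>. The
  first contains 1 and the second contains 0, so connectedness gives a common weight.\<close>

lemma balanced_weight:
  assumes ab: "a \<le> b" and a: "a1 \<ge> 0" "a2 \<ge> 0"
  obtains w c s c' s' where "w \<in> {0..1}" "c \<in> {a..b}" "c' \<in> {a..b}" "s \<in> {0..2}" "s' \<in> {0..2}"
    "\<And>y. y \<in> {a..b} \<Longrightarrow> best w y \<le> obj w c s"
    "\<And>y. y \<in> {a..b} \<Longrightarrow> best w y \<le> obj w c' s'"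
    "a2 * R1 c s - a1 * R2 c s \<ge> 0" "a2 * R1 c' s' - a1 * R2 c' s' \<le> 0"
proof -
  define mx where "mx w c s \<longleftrightarrow> (\<forall>y\<in>{a..b}. \<forall>u\<in>{0..2}. obj w y u \<le> obj w c s)" for w c s
  define g where "g c s = a2 * R1 c s - a1 * R2 c s" for c s
  define N where "N h = {w. \<exists>c\<in>{a..b}. \<exists>s\<in>{0..2}. mx w c s \<and> (0::real) \<le> h c s}" for h
  have ex: "\<exists>c\<in>{a..b}. \<exists>s\<in>{0..2}. mx w c s" for w
  proof -
    have "\<exists>z\<in>{a..b} \<times> {0..2}. \<forall>z'\<in>{a..b} \<times> {0..2}. obj w (fst z') (snd z') \<le> obj w (fst z) (snd z)"
      by (intro continuous_attains_sup compact_Times continuous_intros) (use ab in auto)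
    then obtain z where "z \<in> {a..b} \<times> {0..2}"
      "\<forall>z'\<in>{a..b} \<times> {0..2}. obj w (fst z') (snd z') \<le> obj w (fst z) (snd z)"
      by blast
    then show ?thesis unfolding mx_def by (intro bexI[of _ "fst z"] bexI[of _ "snd z"]) auto
  qed
  have closed: "closed (N g)" "closed (N (\<lambda>c s. - g c s))"
    unfolding N_def mx_def g_def
    by (rule closed_maximizer_weights, unfold split_beta, intro continuous_intros)+
  have cover: "{0..1} \<subseteq> N g \<union> N (\<lambda>c s. - g c s)"
  proof
    fix w
    obtain c s where "c \<in> {a..b}" "s \<in> {0..2}" "mx w c s" using ex by blast
    then show "w \<in> N g \<union> N (\<lambda>c s. - g c s)"
      using linear[of 0 "g c s"] unfolding N_def Un_iff mem_Collect_eq neg_0_le_iff_le by blast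
  qed
  have "1 \<in> N g"
  proof -
    obtain c s where cs: "c \<in> {a..b}" "s \<in> {0..2}" "mx 1 c s" using ex by blast
    \<comment> \<open>With weight 1 only user 1 counts, so the maximizer may be moved to
      \<open>s = 1\<close>, where user 2 has rate 0 and the imbalance is nonnegative. The case of
      weight 0 is symmetric, with \<open>s = 0\<close>.\<close>
    then have "mx 1 c 1" using R1_le[of c s] by (fastforce simp: mx_def obj_def)
    then have "\<exists>s\<in>{0..2}. mx 1 c s \<and> 0 \<le> g c s"
      using a R1_1[of c] R2_1[of c] by (intro bexI[of _ 1]) (auto simp: g_def)
    then show ?thesis unfolding N_def using cs(1) by blast
  qed
  moreover have "0 \<in> N (\<lambda>c s. - g c s)"
  proof -
    obtain c s where cs: "c \<in> {a..b}" "s \<in> {0..2}" "mx 0 c s" using ex by blast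
    then have "mx 0 c 0" using R2_le[of c s] by (fastforce simp: mx_def obj_def)
    then have "\<exists>s\<in>{0..2}. mx 0 c s \<and> 0 \<le> - g c s"
      using a R2_0[of c] R1_0[of c] by (intro bexI[of _ 0]) (auto simp: g_def)
    then show ?thesis unfolding N_def using cs(1) by blast
  qed
  ultimately obtain w where w: "w \<in> {0..1}" "w \<in> N g" "w \<in> N (\<lambda>c s. - g c s)"
    using connected_closedD[OF connected_Icc[of "0::real" 1] _ cover closed] by force
  have best: "best w y \<le> obj w c s" if "mx w c s" "y \<in> {a..b}" for y c s
    using best_attained[of w y] that unfolding mx_def by metis
  from w obtain c s c' s' where "c \<in> {a..b}" "s \<in> {0..2}" "mx w c s" "g c s \<ge> 0"
    "c' \<in> {a..b}" "s' \<in> {0..2}" "mx w c' s'" "g c' s' \<le> 0" unfolding N_def by auto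
  with w(1) best show ?thesis using that[of w c c' s s'] by (auto simp: g_def)
qed

text \<open>
  Weak duality for trajectories with range [a,b]: the crossing of [a,b] takes the time
  (b - a) / V and contributes the integral, the remaining time is spent hovering at c.
\<close>

definition dual_bound :: "real \<Rightarrow> real \<Rightarrow> real \<Rightarrow> real \<Rightarrow> real \<Rightarrow> real \<Rightarrow> real \<Rightarrow> bool" where
  "dual_bound T V a1 a2 a b r \<longleftrightarrow> (\<forall>w\<in>{0..1}. \<exists>c\<in>{a..b}.
     r * T * (w * a1 + (1 - w) * a2) \<le> (T - (b - a) / V) * best w c + integral {a..b} (best w) / V)"

text \<open>One inequality, at the balanced weight, suffices: the chosen window serves the users
  exactly in the ratio \<open>a1 : a2\<close>, so a lower bound on its weighted rate bounds the rate
  of each user.\<close>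

lemma hfh_attains:
  assumes V: "V > 0" and T: "T > 0" and ab: "a \<le> b" and len: "b - a \<le> V * T"
    and a: "a1 \<ge> 0" "a2 \<ge> 0" "a1 + a2 = 1"
    and bound: "dual_bound T V a1 a2 a b r"
  obtains xI xF tI tF Y where "a \<le> xI" "xI \<le> xF" "xF \<le> b" "tI \<ge> 0" "tF \<ge> 0"
    "tI + (xF - xI) / V + tF = T" "Y \<in> borel_measurable borel" "\<And>t. Y t \<in> {0..2}"
    "a1 * r * T \<le> integral {0..T} (\<lambda>t. R1 (hfh_traj T V xI xF tI tF t) (Y t))"
    "a2 * r * T \<le> integral {0..T} (\<lambda>t. R2 (hfh_traj T V xI xF tI tF t) (Y t))"
proof -
  define g where "g c s = a2 * R1 c s - a1 * R2 c s" for c s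
  obtain w c s c' s' where w: "w \<in> {0..1}" and cs: "c \<in> {a..b}" "c' \<in> {a..b}" "s \<in> {0..2}" "s' \<in> {0..2}"
    "\<And>y. y \<in> {a..b} \<Longrightarrow> best w y \<le> obj w c s"
    "\<And>y. y \<in> {a..b} \<Longrightarrow> best w y \<le> obj w c' s'" "g c s \<ge> 0" "g c' s' \<le> 0"
    using balanced_weight[OF ab a(1,2)] unfolding g_def by metis
  \<comment> \<open>The two maximizers are relabelled so that the flight goes to the right; either
    of them may then be the one favouring user 1.\<close>
  obtain c1 s1 c2 s2 where c12: "c1 \<le> c2" "c1 \<in> {a..b}" "c2 \<in> {a..b}"
    and s12: "s1 \<in> {0..2}" "s2 \<in> {0..2}"
    and mx: "\<And>y. y \<in> {a..b} \<Longrightarrow> best w y \<le> obj w c1 s1" "\<And>y. y \<in> {a..b} \<Longrightarrow> best w y \<le> obj w c2 s2"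
    and sgn: "g c1 s1 \<le> 0 \<and> 0 \<le> g c2 s2 \<or> g c2 s2 \<le> 0 \<and> 0 \<le> g c1 s1"
  proof (cases "c \<le> c'")
    case True
    show ?thesis by (rule that[OF True cs(1,2,3,4,5,6)]) (use cs in auto)
  next
    case False
    then have "c' \<le> c" by simp
    show ?thesis by (rule that[OF \<open>c' \<le> c\<close> cs(2,1,4,3,6,5)]) (use cs in auto)
  qed
  define M where "M = best w c1"
  have M: "obj w c1 s1 = best w c1" "obj w c2 s2 = best w c2" "best w c2 = M"
    "\<And>y. y \<in> {a..b} \<Longrightarrow> best w y \<le> M"
  proof -
    have "best w c1 \<le> obj w c1 s1" "best w c2 \<le> obj w c1 s1" "best w c1 \<le> obj w c2 s2" "best w c2 \<le> obj w c2 s2"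
      using mx c12 by blast+
    with best_upper[OF s12(1), of w c1] best_upper[OF s12(2), of w c2]
    show "obj w c1 s1 = best w c1" "obj w c2 s2 = best w c2" "best w c2 = M"
      unfolding M_def by linarith+
    then show "best w y \<le> M" if "y \<in> {a..b}" for y using mx(1)[OF that] unfolding M_def by simp
  qed
  define d where "d = (c2 - c1) / V"
  have c2: "c2 = c1 + V * d" using V by (simp add: d_def)
  have "c2 - c1 \<le> V * T" using c12 len by auto
  then have d: "0 \<le> d" "d \<le> T" using V c12 by (auto simp: d_def field_simps)
  have "continuous_on UNIV (\<lambda>(x, s). obj w x s)"
    unfolding split_beta by (intro continuous_intros)
  then obtain m where m: "m \<in> borel_measurable borel" "\<And>x. m x \<in> {0..2}" "\<And>x. obj w x (m x) = best w x"
    using measurable_argmax[of 0 2 "obj w"] unfolding best_def by auto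
  define X where "X = long_traj T V c1 d"
  \<comment> \<open>While hovering, the maximizers \<open>s1\<close> and \<open>s2\<close> with
    known sign of \<open>g\<close> must be kept, as \<open>m\<close> may select others. In flight
    any measurable choice of maximizers will do.\<close>
  define Y where "Y t = (if t \<le> T then s1 else if t < T + d then m (X t) else s2)" for t
  have Xc: "continuous_on S X" for S unfolding X_def by (rule long_traj_continuous)
  have [measurable, simp]: "X \<in> borel_measurable borel" "m \<in> borel_measurable borel"
    using m(1) borel_measurable_continuous_onI[OF Xc] by auto
  have Ym [measurable, simp]: "Y \<in> borel_measurable borel"
    unfolding Y_def[abs_def] by measurable
  have Y: "Y t \<in> {0..2}" for t using s12 m(2) by (auto simp: Y_def)
  have X: "X t \<in> {c1..c2}" for t
    using V d by (auto simp: X_def long_traj_def c2)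
  have Xlo: "X t = c1" if "t \<le> T" for t using that d by (auto simp: X_def long_traj_def)
  have Xhi: "X t = c2" if "t \<ge> T + d" for t using that d by (auto simp: X_def long_traj_def c2)
  have objXY: "obj w (X t) (Y t) = best w (X t)" for t
    using M m(3) Xlo[of t] Xhi[of t] by (auto simp: Y_def)
  have R_int: "(\<lambda>t. R (X t) (Y t)) integrable_on {u..v}"
    if R: "continuous_on UNIV (\<lambda>(x, s). R x s)" for R :: "real \<Rightarrow> real \<Rightarrow> real" and u v
  proof -
    have "compact ((\<lambda>(x, s). R x s) ` ({c1..c2} \<times> {0..2}))"
      by (intro compact_continuous_image continuous_on_subset[OF R] compact_Times) auto
    then obtain B where "\<forall>z\<in>(\<lambda>(x, s). R x s) ` ({c1..c2} \<times> {0..2}). norm z \<le> B"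
      using compact_imp_bounded bounded_iff by metis
    then have B: "\<bar>R x s\<bar> \<le> B" if "x \<in> {c1..c2}" "s \<in> {0..2}" for x s
      using that by force
    have "(\<lambda>t. R (X t) (Y t)) \<in> borel_measurable borel"
      by (rule borel_measurable_continuous_Pair) (use R in \<open>simp_all add: case_prod_unfold\<close>)
    then show ?thesis by (rule bounded_borel_integral(2)) (rule B[OF X Y])
  qed
  have int1: "(\<lambda>t. R1 (X t) (Y t)) integrable_on {u..v}" for u v by (rule R_int[OF R1_cont])
  have int2: "(\<lambda>t. R2 (X t) (Y t)) integrable_on {u..v}" for u v by (rule R_int[OF R2_cont])
  have intb: "(\<lambda>t. best w (X t)) integrable_on {u..v}" for u v
    by (intro integrable_continuous_interval continuous_on_compose2[OF best_cont Xc]) auto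
  have intg: "(\<lambda>t. g (X t) (Y t)) integrable_on {u..v}" for u v
    unfolding g_def by (intro integrable_diff integrable_on_mult_right int1 int2)
  define W where "W tau = integral {tau..tau + T} (\<lambda>t. g (X t) (Y t))" for tau
  have "\<exists>tau\<in>{0..T + d}. W tau = 0"
  proof -
    have Wc: "continuous_on {0..T + d} W"
      unfolding W_def[abs_def] by (rule window_integral_continuous[OF intg]) (use T in simp)
    have "W 0 = integral {0..T} (\<lambda>t. g c1 s1)"
      unfolding W_def add_0 by (rule integral_cong) (simp add: Xlo Y_def)
    then have W0: "W 0 = T * g c1 s1" using T by simp
    \<comment> \<open>The single time \<open>T + d\<close> is negligible; if \<open>d = 0\<close>,
      the value of \<open>Y\<close> there is still \<open>s1\<close>.\<close>
    have "W (T + d) = integral {T + d..T + d + T} (\<lambda>t. g c2 s2)"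
      unfolding W_def
      by (rule integral_spike[of "{T + d}"]) (use d in \<open>auto simp: Xhi Y_def\<close>)
    then have W1: "W (T + d) = T * g c2 s2" using T by simp
    have "\<exists>tau\<ge>0. tau \<le> T + d \<and> W tau = 0"
      using sgn
    proof
      assume "g c1 s1 \<le> 0 \<and> 0 \<le> g c2 s2"
      then show ?thesis
        by (intro IVT'[OF _ _ _ Wc]) (use T d in \<open>auto simp: W0 W1 mult_nonneg_nonpos\<close>)
    next
      assume "g c2 s2 \<le> 0 \<and> 0 \<le> g c1 s1"
      then show ?thesis
        by (intro IVT2'[OF _ _ _ Wc]) (use T d in \<open>auto simp: W0 W1 mult_nonneg_nonpos\<close>)
    qed
    then show ?thesis by auto
  qed
  then obtain tau where tau: "0 \<le> tau" "tau \<le> T + d" "W tau = 0" by auto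
  define I1 where "I1 = integral {tau..tau + T} (\<lambda>t. R1 (X t) (Y t))"
  define I2 where "I2 = integral {tau..tau + T} (\<lambda>t. R2 (X t) (Y t))"
  have "W tau = a2 * I1 - a1 * I2"
    unfolding W_def g_def I1_def I2_def using int1 int2 by (simp add: integral_diff integrable_on_mult_right)
  then have bal: "a2 * I1 = a1 * I2" using tau by simp
  have I_best: "w * I1 + (1 - w) * I2 = integral {tau..tau + T} (\<lambda>t. best w (X t))"
    unfolding I1_def I2_def objXY[symmetric] obj_def
    using int1 int2 by (simp add: integral_add integrable_on_mult_right)
  \<comment> \<open>Positivity of the weighted rate excludes
    \<open>w * a1 + (1 - w) * a2 = 0\<close>, so this factor can be cancelled below.\<close>
  have I_pos: "integral {tau..tau + T} (\<lambda>t. best w (X t)) > 0"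
  proof -
    obtain z where z: "z \<in> {c1..c2}" "\<And>y. y \<in> {c1..c2} \<Longrightarrow> best w z \<le> best w y"
      using continuous_attains_inf[of "{c1..c2}" "best w"] c12 continuous_on_subset[OF best_cont] by auto
    have "0 < T * best w z" using T best_pos w by auto
    also have "\<dots> = integral {tau..tau + T} (\<lambda>t. best w z)" using T by simp
    also have "\<dots> \<le> integral {tau..tau + T} (\<lambda>t. best w (X t))"
      using z(2)[OF X] by (intro integral_le intb) auto
    finally show ?thesis .
  qed
  \<comment> \<open>The loss against hovering at a best position of \<open>{a..b}\<close>. It
    vanishes at \<open>c1\<close> and \<open>c2\<close>, so a window loses at most what one flight
    over \<open>{c1..c2}\<close> loses, hence at most what one over \<open>{a..b}\<close>
    loses.\<close>
  define G where "G y = M - best w y" for y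
  have G: "continuous_on UNIV G" unfolding G_def by (intro continuous_intros best_cont)
  have Gi: "G integrable_on {u..v}" for u v
    by (rule integrable_continuous_interval) (rule continuous_on_subset[OF G], auto)
  have "V * integral {tau..tau + T} (\<lambda>t. G (X t)) \<le> integral {c1..c2} G"
    using long_traj_integral_le[OF V _ d(1) tau(1,2) G, of c1] T M c12 
    by (auto simp: X_def c2[symmetric] G_def M_def)
  also have "\<dots> \<le> integral {a..b} G"
    using c12 M(4) by (intro integral_subset_le_nonneg Gi) (auto simp: G_def)
  also have "\<dots> = M * (b - a) - integral {a..b} (best w)"
    using Henstock_Kurzweil_Integration.integral_diff[OF integrable_const_ivl[of M a b] best_integrable[of w a b]] ab
    by (simp add: G_def[abs_def] mult.commute)
  also have "integral {tau..tau + T} (\<lambda>t. G (X t)) = M * T - integral {tau..tau + T} (\<lambda>t. best w (X t))"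
    using Henstock_Kurzweil_Integration.integral_diff[OF integrable_const_ivl[of M tau "tau + T"] intb[of tau "tau + T"]] T
    by (simp add: G_def mult.commute)
  finally have "(T - (b - a) / V) * M + integral {a..b} (best w) / V \<le> w * I1 + (1 - w) * I2"
    unfolding I_best using V by (simp add: field_simps)
  moreover obtain y where "y \<in> {a..b}"
    "r * T * (w * a1 + (1 - w) * a2) \<le> (T - (b - a) / V) * best w y + integral {a..b} (best w) / V"
    using bound w unfolding dual_bound_def by blast
  moreover have "(T - (b - a) / V) * best w y \<le> (T - (b - a) / V) * M"
    using M(4)[OF \<open>y \<in> {a..b}\<close>] len V by (intro mult_left_mono) (auto simp: field_simps)
  ultimately have key: "r * T * (w * a1 + (1 - w) * a2) \<le> w * I1 + (1 - w) * I2" by linarith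
  \<comment> \<open>Balance together with \<open>a1 + a2 = 1\<close> fixes the share of each user in
    the total.\<close>
  have I: "I1 = a1 * (I1 + I2)" "I2 = a2 * (I1 + I2)"
    using bal a(3) by (simp_all add: algebra_simps) (metis distrib_left mult.right_neutral add.commute mult.commute)+
  have W_eq: "w * I1 + (1 - w) * I2 = (I1 + I2) * (w * a1 + (1 - w) * a2)"
    by (subst I(1), subst (2) I(2)) (simp add: algebra_simps)
  have "w * a1 + (1 - w) * a2 \<noteq> 0" using W_eq I_pos I_best by auto
  then have "w * a1 + (1 - w) * a2 > 0" using w a by (simp add: order_less_le)
  then have rT: "r * T \<le> I1 + I2" using key W_eq by auto
  have I1: "a1 * r * T \<le> I1" "a2 * r * T \<le> I2"
    using I mult_left_mono[OF rT a(1)] mult_left_mono[OF rT a(2)] by (simp_all add: mult.assoc)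
  define xI xF tI tF where "xI = X tau" "xF = X (tau + T)" "tI = max 0 (T - tau)" "tF = max 0 (tau - d)"
  note win = long_traj_window[OF V d tau(1,2), where ?c1.0 = c1, folded X_def, folded xI_xF_tI_tF_def]
  show ?thesis
  proof (rule that[of xI xF tI tF "\<lambda>t. Y (tau + t)"])
    show "a \<le> xI" "xF \<le> b" using X[of tau] X[of "tau + T"] c12 by (auto simp: xI_xF_tI_tF_def)
    show "xI \<le> xF" using V T by (auto simp: xI_xF_tI_tF_def X_def long_traj_def intro!: mult_left_mono)
    show "tI \<ge> 0" "tF \<ge> 0" by (auto simp: xI_xF_tI_tF_def)
    show "tI + (xF - xI) / V + tF = T" by (rule win(1))
    show "(\<lambda>t. Y (tau + t)) \<in> borel_measurable borel" by measurable
    show "Y (tau + t) \<in> {0..2}" for t by (rule Y)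
    have "integral {0..T} (\<lambda>t. R (hfh_traj T V xI xF tI tF t) (Y (tau + t)))
        = integral {tau..tau + T} (\<lambda>t. R (X t) (Y t))" for R :: "real \<Rightarrow> real \<Rightarrow> real"
    proof -
      have "integral {0..T} (\<lambda>t. R (hfh_traj T V xI xF tI tF t) (Y (tau + t)))
          = integral {0..T} ((\<lambda>t. R (X t) (Y t)) \<circ> ((+) tau))"
        by (rule integral_cong) (simp add: win(2))
      then show ?thesis by (simp add: integral_shift_Icc_real add.commute)
    qed
    then show "a1 * r * T \<le> integral {0..T} (\<lambda>t. R1 (hfh_traj T V xI xF tI tF t) (Y (tau + t)))"
      "a2 * r * T \<le> integral {0..T} (\<lambda>t. R2 (hfh_traj T V xI xF tI tF t) (Y (tau + t)))"
      using I1 by (simp_all add: I1_def I2_def)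
  qed
qed

section \<open>Upper bounds on the value: existence of the largest one and validity for
  trajectories\<close>

lemma closed_dual_bound:
  assumes lu: "l \<le> u" and V: "V > 0"
  shows "closed {(a, b, r). l \<le> a \<and> a \<le> b \<and> b \<le> u \<and> b - a \<le> V * T \<and> 0 \<le> r \<and> dual_bound T V a1 a2 a b r}"
    (is "closed ?K")
proof -
  \<comment> \<open>Clamping makes the indefinite integral continuous on the whole line, so that the
    integral over \<open>{a..b}\<close> becomes a continuous expression in both endpoints.\<close>
  define J where "J w x = integral {l..max l (min u x)} (best w)" for w x
  have J: "continuous_on UNIV (J w)" for w
    unfolding J_def
    by (rule continuous_on_compose2[OF indefinite_integral_continuous_1[OF best_integrable], of _ _ l u])
       (use lu in \<open>auto intro!: continuous_intros\<close>)
  have J_diff: "integral {a..b} (best w) = J w b - J w a" if "l \<le> a" "a \<le> b" "b \<le> u" for w a b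
    using Henstock_Kurzweil_Integration.integral_combine[of l a b "best w"] best_integrable that
    by (simp add: J_def)
  define Q where "Q w = {p :: real \<times> real \<times> real \<times> real. case p of (c, a, b, r) \<Rightarrow>
    (a \<le> c \<and> c \<le> b \<and>
      r * T * (w * a1 + (1 - w) * a2) \<le> (T - (b - a) / V) * best w c + (J w b - J w a) / V)}" for w
  define C where "C = {p :: real \<times> real \<times> real. case p of (a, b, r) \<Rightarrow>
    l \<le> a \<and> a \<le> b \<and> b \<le> u \<and> b - a \<le> V * T \<and> 0 \<le> r}"
  have "closed C"
    unfolding C_def case_prod_unfold
    by (intro closed_Collect_conj closed_Collect_le continuous_intros)
  have "closed (Q w)" for w
    unfolding Q_def case_prod_unfold
    by (intro closed_Collect_conj closed_Collect_le continuous_intros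
        continuous_on_compose2[OF best_cont] continuous_on_compose2[OF J]) (use V in auto)
  then have P: "closed {p. \<exists>c. c \<in> {l..u} \<and> (c, p) \<in> Q w}" for w
    by (intro closed_compact_projection) auto
  \<comment> \<open>For each fixed \<open>w\<close>, the choice of \<open>c\<close> is a projection
    along the compact interval \<open>{l..u}\<close>, which preserves closedness; the quantifier
    over \<open>w\<close> becomes an intersection.\<close>
  have "?K = C \<inter> (\<Inter>w\<in>{0..1}. {p. \<exists>c. c \<in> {l..u} \<and> (c, p) \<in> Q w})"
  proof -
    have "(\<exists>c\<in>{a..b}. r * T * (w * a1 + (1 - w) * a2)
          \<le> (T - (b - a) / V) * best w c + integral {a..b} (best w) / V)
        \<longleftrightarrow> (\<exists>c. c \<in> {l..u} \<and> (c, a, b, r) \<in> Q w)"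
      if "(a, b, r) \<in> C" for w a b r
    proof -
      have abr: "l \<le> a" "a \<le> b" "b \<le> u" using that by (auto simp: C_def)
      have "(c, a, b, r) \<in> Q w \<longleftrightarrow> c \<in> {a..b} \<and> r * T * (w * a1 + (1 - w) * a2)
          \<le> (T - (b - a) / V) * best w c + integral {a..b} (best w) / V" for c
        unfolding Q_def J_diff[OF abr] by auto
      moreover have "c \<in> {l..u}" if "c \<in> {a..b}" for c using that abr by auto
      ultimately show ?thesis by blast
    qed
    then show ?thesis unfolding dual_bound_def by (force simp: C_def)
  qed
  then show ?thesis
    by (simp only:) (intro closed_Int closed_INT ballI \<open>closed C\<close> P)
qed

text \<open>The admissible triples \<open>(a, b, r)\<close> form a closed set, which the inequality
  for \<open>w = 1/2\<close> shows to be bounded. The coordinate \<open>r\<close> therefore attains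
  its maximum.\<close>

lemma exists_largest_dual_bound:
  assumes lu: "l \<le> u" and V: "V > 0" and T: "T > 0" and a: "a1 \<ge> 0" "a2 \<ge> 0" "a1 + a2 = 1"
  obtains a b r where "l \<le> a" "a \<le> b" "b \<le> u" "b - a \<le> V * T" "0 \<le> r" "dual_bound T V a1 a2 a b r"
    "\<And>a' b' r'. l \<le> a' \<Longrightarrow> a' \<le> b' \<Longrightarrow> b' \<le> u \<Longrightarrow> b' - a' \<le> V * T \<Longrightarrow>
      dual_bound T V a1 a2 a' b' r' \<Longrightarrow> r' \<le> r"
proof -
  define K where "K = {(a, b, r). l \<le> a \<and> a \<le> b \<and> b \<le> u \<and> b - a \<le> V * T \<and> 0 \<le> r \<and> dual_bound T V a1 a2 a b r}"
  obtain z where z: "z \<in> {l..u}" "\<And>y. y \<in> {l..u} \<Longrightarrow> best (1/2) y \<le> best (1/2) z"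
    using continuous_attains_sup[of "{l..u}" "best (1/2)"] lu continuous_on_subset[OF best_cont] by auto
  define B where "B = 2 * best (1/2) z"
  have rB: "r \<le> B" if "(a, b, r) \<in> K" for a b r
  proof -
    have ab: "l \<le> a" "a \<le> b" "b \<le> u" "b - a \<le> V * T" and "dual_bound T V a1 a2 a b r"
      using that by (auto simp: K_def)
    then obtain c where c: "c \<in> {a..b}"
      "r * T * (1/2 * a1 + (1 - 1/2) * a2) \<le> (T - (b - a) / V) * best (1/2) c + integral {a..b} (best (1/2)) / V"
      unfolding dual_bound_def by (auto dest: bspec[of _ _ "1/2"])
    have "(T - (b - a) / V) * best (1/2) c \<le> (T - (b - a) / V) * best (1/2) z"
      using ab c V by (intro mult_left_mono z) (auto simp: field_simps)
    moreover have "integral {a..b} (best (1/2)) \<le> integral {a..b} (\<lambda>_. best (1/2) z)"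
      using ab by (intro integral_le best_integrable z) auto
    then have "integral {a..b} (best (1/2)) / V \<le> (b - a) / V * best (1/2) z"
      using ab V by (simp add: divide_right_mono)
    moreover have "1/2 * a1 + (1 - 1/2) * a2 = 1/2" using a(3) by argo
    then have "r * T * (1/2) \<le> (T - (b - a) / V) * best (1/2) c + integral {a..b} (best (1/2)) / V"
      using c(2) by (simp only:)
    moreover have "(T - (b - a) / V) * best (1/2) z + (b - a) / V * best (1/2) z = T * best (1/2) z"
      by (simp add: algebra_simps)
    ultimately have "r * T * (1/2) \<le> T * best (1/2) z" by linarith
    then show ?thesis using T by (simp add: B_def)
  qed
  have "K \<subseteq> {l..u} \<times> {l..u} \<times> {0..B}"
    using rB by (auto simp: K_def)
  moreover have "compact ({l..u} \<times> {l..u} \<times> {0..B})"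
    by (intro compact_Times compact_Icc)
  ultimately have "bounded K"
    using bounded_subset compact_imp_bounded by blast
  moreover have "closed K"
    unfolding K_def by (rule closed_dual_bound[OF lu V])
  ultimately have "compact K"
    by (simp add: compact_eq_bounded_closed)
  \<comment> \<open>The degenerate interval with value 0 is admissible because \<open>best\<close>
    is positive.\<close>
  moreover have "(l, l, 0) \<in> K"
    using lu V T best_pos[of _ l] unfolding K_def dual_bound_def
    by (auto simp: order_less_imp_le)
  ultimately obtain p where p: "p \<in> K" "\<And>q. q \<in> K \<Longrightarrow> snd (snd q) \<le> snd (snd p)"
    using continuous_attains_sup[of K "\<lambda>q. snd (snd q)"]
      continuous_on_snd[OF continuous_on_snd[OF continuous_on_id]] by blast
  obtain a b r where abr: "p = (a, b, r)" by (cases p)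
  have "r' \<le> r" if "l \<le> a'" "a' \<le> b'" "b' \<le> u" "b' - a' \<le> V * T" "dual_bound T V a1 a2 a' b' r'" for a' b' r'
  proof (cases "r' \<ge> 0")
    case True
    then show ?thesis using p(2)[of "(a', b', r')"] that abr by (auto simp: K_def)
  next
    case False
    then show ?thesis using p(1) abr by (auto simp: K_def)
  qed
  then show ?thesis using that[of a b r] p(1) abr by (auto simp: K_def)
qed

text \<open>The range of the trajectory is the interval \<open>{a..b}\<close>. For each weight, the
  occupation inequality is applied to the loss \<open>best w c - best w y\<close>, where
  \<open>c\<close> maximizes \<open>best w\<close> on that interval; rearranging it gives the
  bound.\<close>

lemma dual_bound_of_trajectory:
  assumes V: "V > 0" and T: "T > 0" and lip: "V-lipschitz_on {0..T} x"
    and range: "x ` {0..T} \<subseteq> {l..u}"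
    and le: "\<And>w. w \<in> {0..1} \<Longrightarrow>
      r * T * (w * a1 + (1 - w) * a2) \<le> integral {0..T} (\<lambda>t. best w (x t))"
  obtains a b where "l \<le> a" "a \<le> b" "b \<le> u" "b - a \<le> V * T" "dual_bound T V a1 a2 a b r"
proof -
  have xc: "continuous_on {0..T} x" by (rule lipschitz_on_continuous_on[OF lip])
  obtain a b where ab: "x ` {0..T} = {a..b}"
    using connected_compact_interval_1[of "x ` {0..T}"] compact_continuous_image[OF xc]
      connected_continuous_image[OF xc] by auto
  have "a \<le> b" using ab T by (metis atLeastatMost_empty_iff image_is_empty less_imp_le)
  then obtain ta tb where t: "ta \<in> {0..T}" "x ta = a" "tb \<in> {0..T}" "x tb = b"
    using ab by (metis atLeastAtMost_iff imageE order_refl)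
  have "b - a \<le> V * \<bar>tb - ta\<bar>"
    using lipschitz_onD[OF lip t(3,1)] t by (simp add: dist_real_def)
  also have "\<dots> \<le> V * T" using V t by (intro mult_left_mono) auto
  finally have len: "b - a \<le> V * T" .
  have "dual_bound T V a1 a2 a b r"
    unfolding dual_bound_def
  proof
    fix w :: real assume w: "w \<in> {0..1}"
    obtain c where c: "c \<in> {a..b}" "\<And>y. y \<in> {a..b} \<Longrightarrow> best w y \<le> best w c"
      using continuous_attains_sup[of "{a..b}" "best w"] \<open>a \<le> b\<close> continuous_on_subset[OF best_cont] by auto
    have xi: "(\<lambda>t. best w (x t)) integrable_on {0..T}"
      by (intro integrable_continuous_interval continuous_on_compose2[OF best_cont xc]) auto
    have "integral {a..b} (\<lambda>y. best w c - best w y) \<le> V * integral {0..T} (\<lambda>t. best w c - best w (x t))"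
      by (rule occupation_integral[OF _ V lip _ _ ab])
         (use T c in \<open>auto intro!: continuous_intros best_cont\<close>)
    also have "integral {0..T} (\<lambda>t. best w c - best w (x t)) = T * best w c - integral {0..T} (\<lambda>t. best w (x t))"
      using Henstock_Kurzweil_Integration.integral_diff[OF integrable_const_ivl[of "best w c" 0 T] xi] T by simp
    also have "integral {a..b} (\<lambda>y. best w c - best w y) = (b - a) * best w c - integral {a..b} (best w)"
      using Henstock_Kurzweil_Integration.integral_diff[OF integrable_const_ivl[of "best w c" a b] best_integrable[of w a b]]
        \<open>a \<le> b\<close> by simp
    finally have "integral {0..T} (\<lambda>t. best w (x t)) \<le> (T - (b - a) / V) * best w c + integral {a..b} (best w) / V"
      using V by (simp add: field_simps)
    with le[OF w] c(1) show "\<exists>c\<in>{a..b}. r * T * (w * a1 + (1 - w) * a2)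
        \<le> (T - (b - a) / V) * best w c + integral {a..b} (best w) / V"
      by (intro bexI[of _ c]) auto
  qed
  with len \<open>a \<le> b\<close> range ab show ?thesis using that[of a b] by auto
qed

end

section \<open>The two-user channel\<close>

locale two_user_channel =
  fixes beta0 H D P :: real
  assumes pos: "beta0 > 0" "H > 0" "D > 0" "P > 0"
begin

definition rate1 :: "real \<Rightarrow> real \<Rightarrow> real" where
  "rate1 x p = log 2 (1 + p * h1 beta0 H D x)"

definition rate2 :: "real \<Rightarrow> real \<Rightarrow> real" where
  "rate2 x q = log 2 (1 + q * h2 beta0 H D x)"

definition rate12 :: "real \<Rightarrow> real \<Rightarrow> real \<Rightarrow> real" where
  "rate12 x p q = log 2 (1 + p * h1 beta0 H D x + q * h2 beta0 H D x)"

text \<open>A tent with peak \<open>P\<close> at \<open>s = 1\<close>; cutting it off at 0 keeps the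
  power within \<open>{0..P}\<close> for every real \<open>s\<close>.\<close>

definition loop_power :: "real \<Rightarrow> real" where
  "loop_power s = P * max 0 (1 - \<bar>s - 1\<bar>)"

text \<open>
  For fixed powers (p, q) with p + q = P, the maximal-sum-rate edge of the rate pentagon has two
  corners.  The loop follows the corner with r1 maximal for s in [0,1], where p grows from 0 to P,
  and the corner with r2 maximal for s in [1,2], where p returns to 0.
  At s = 1 the two corners coincide because user 2 has no power.
\<close>

definition R1 :: "real \<Rightarrow> real \<Rightarrow> real" where
  "R1 x s = (if s \<le> 1 then rate1 x (loop_power s) else rate12 x (loop_power s) (P - loop_power s) - rate2 x (P - loop_power s))"

definition R2 :: "real \<Rightarrow> real \<Rightarrow> real" where
  "R2 x s = (if s \<le> 1 then rate12 x (loop_power s) (P - loop_power s) - rate1 x (loop_power s) else rate2 x (P - loop_power s))"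

lemma gain_pos [simp]: "h1 beta0 H D x > 0" "h2 beta0 H D x > 0"
  using pos by (auto simp: h1_def h2_def chan_gain_def intro!: divide_pos_pos add_nonneg_pos)

lemma gain_cont [continuous_intros]:
  assumes "continuous_on S f"
  shows "continuous_on S (\<lambda>z. h1 beta0 H D (f z))" "continuous_on S (\<lambda>z. h2 beta0 H D (f z))"
proof -
  have "(y :: real)\<^sup>2 + H\<^sup>2 \<noteq> 0" for y using pos by (simp add: sum_power2_eq_zero_iff)
  then show "continuous_on S (\<lambda>z. h1 beta0 H D (f z))" "continuous_on S (\<lambda>z. h2 beta0 H D (f z))"
    unfolding h1_def h2_def chan_gain_def by (auto intro!: continuous_intros assms)
qed

lemma loop_power_bounds: "0 \<le> loop_power s" "loop_power s \<le> P"
  using pos by (auto simp: loop_power_def)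

lemma loop_power_simps [simp]: "loop_power 0 = 0" "loop_power 1 = P"
  by (simp_all add: loop_power_def)

lemma loop_power_cont [continuous_intros]: "continuous_on S f \<Longrightarrow> continuous_on S (\<lambda>z. loop_power (f z))"
  unfolding loop_power_def by (intro continuous_intros)

lemma rate_arg_pos:
  assumes "p \<ge> 0" "q \<ge> 0"
  shows "1 + p * h1 beta0 H D x > 0" "1 + q * h2 beta0 H D x > 0"
    "1 + p * h1 beta0 H D x + q * h2 beta0 H D x > 0"
  using assms mult_nonneg_nonneg[OF assms(1) less_imp_le[OF gain_pos(1)[of x]]]
    mult_nonneg_nonneg[OF assms(2) less_imp_le[OF gain_pos(2)[of x]]] by linarith+

text \<open>The product of the two single-user arguments exceeds the joint argument by a nonnegative
  cross term.\<close>

lemma rate12_le: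
  assumes "p \<ge> 0" "q \<ge> 0"
  shows "rate12 x p q \<le> rate1 x p + rate2 x q"
proof -
  have "1 + p * h1 beta0 H D x + q * h2 beta0 H D x
      \<le> (1 + p * h1 beta0 H D x) * (1 + q * h2 beta0 H D x)"
    using assms less_imp_le[OF gain_pos(1)[of x]] less_imp_le[OF gain_pos(2)[of x]]
    by (simp add: algebra_simps)
  then show ?thesis
    using rate_arg_pos[OF assms, of x] unfolding rate1_def rate2_def rate12_def
    by (subst log_mult_pos[symmetric]) auto
qed

lemma rate_nonneg:
  assumes "p \<ge> 0" "q \<ge> 0"
  shows "0 \<le> rate1 x p" "0 \<le> rate2 x q" "rate1 x p \<le> rate12 x p q" "rate2 x q \<le> rate12 x p q"
proof -
  have *: "0 \<le> p * h1 beta0 H D x" "0 \<le> q * h2 beta0 H D x"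
    using assms less_imp_le[OF gain_pos(1)[of x]] less_imp_le[OF gain_pos(2)[of x]] by auto
  then show "0 \<le> rate1 x p" "0 \<le> rate2 x q" "rate1 x p \<le> rate12 x p q" "rate2 x q \<le> rate12 x p q"
    using rate_arg_pos[OF assms, of x] unfolding rate1_def rate2_def rate12_def by auto
qed

lemma rate_mono:
  assumes "0 \<le> p" "p \<le> p'" "0 \<le> q" "q \<le> q'"
    and "h1 beta0 H D x \<le> h1 beta0 H D x'" "h2 beta0 H D x \<le> h2 beta0 H D x'"
  shows "rate1 x p \<le> rate1 x' p'" "rate2 x q \<le> rate2 x' q'" "rate12 x p q \<le> rate12 x' p' q'"
proof -
  have "p * h1 beta0 H D x \<le> p' * h1 beta0 H D x'" "q * h2 beta0 H D x \<le> q' * h2 beta0 H D x'"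
    using assms less_imp_le[OF gain_pos(1)] less_imp_le[OF gain_pos(2)] by (auto intro!: mult_mono)
  then show "rate1 x p \<le> rate1 x' p'" "rate2 x q \<le> rate2 x' q'" "rate12 x p q \<le> rate12 x' p' q'"
    using rate_arg_pos[OF assms(1,3), of x] unfolding rate1_def rate2_def rate12_def
    by (auto intro!: log_mono)
qed

lemma R_sum: "R1 x s + R2 x s = rate12 x (loop_power s) (P - loop_power s)"
  by (simp add: R1_def R2_def)

lemma R_le: "R1 x s \<le> rate1 x (loop_power s)" "R2 x s \<le> rate2 x (P - loop_power s)"
  using rate12_le[of "loop_power s" "P - loop_power s" x] loop_power_bounds[of s] by (auto simp: R1_def R2_def)

lemma R_cont: "continuous_on UNIV (\<lambda>(x, s). R1 x s)" "continuous_on UNIV (\<lambda>(x, s). R2 x s)"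
proof -
  have arg [simp]: "1 + loop_power s * h1 beta0 H D x \<noteq> 0" "1 + (P - loop_power s) * h2 beta0 H D x \<noteq> 0"
    "1 + loop_power s * h1 beta0 H D x + (P - loop_power s) * h2 beta0 H D x \<noteq> 0" for s x
    using rate_arg_pos[of "loop_power s" "P - loop_power s" x] loop_power_bounds[of s] by auto
  have c1: "continuous_on S (\<lambda>z. rate1 (fst z) (loop_power (snd z)))" for S
    unfolding rate1_def using arg
    by (auto intro!: continuous_intros)
  have c2: "continuous_on S (\<lambda>z. rate2 (fst z) (P - loop_power (snd z)))" for S
    unfolding rate2_def using arg
    by (auto intro!: continuous_intros)
  have c12: "continuous_on S (\<lambda>z. rate12 (fst z) (loop_power (snd z)) (P - loop_power (snd z)))" for S
    unfolding rate12_def using arg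
    by (auto intro!: continuous_intros)
  show "continuous_on UNIV (\<lambda>(x, s). R1 x s)"
    unfolding R1_def case_prod_unfold
    by (intro continuous_on_cases_le c1 c2 c12 continuous_on_diff continuous_intros)
       (simp add: rate1_def rate2_def rate12_def)
  show "continuous_on UNIV (\<lambda>(x, s). R2 x s)"
    unfolding R2_def case_prod_unfold
    by (intro continuous_on_cases_le c1 c2 c12 continuous_on_diff continuous_intros)
       (simp add: rate1_def rate2_def rate12_def)
qed

sublocale rate_loop R1 R2
proof
  show "continuous_on UNIV (\<lambda>(x, s). R1 x s)" "continuous_on UNIV (\<lambda>(x, s). R2 x s)"
    by (rule R_cont)+
  show "R1 x 0 = 0" for x by (simp add: R1_def rate1_def)
  show "R2 x 1 = 0" for x by (simp add: R2_def rate1_def rate12_def)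
  have 0: "R2 x 0 = rate2 x P" for x by (simp add: R2_def rate1_def rate2_def rate12_def)
  have 1: "R1 x 1 = rate1 x P" for x by (simp add: R1_def)
  show "R2 x 0 > 0" "R1 x 1 > 0" for x
    unfolding 0 1 using pos rate_arg_pos[of P P x] mult_pos_pos[of P] by (simp_all add: rate1_def rate2_def)
  show "R2 x s \<le> R2 x 0" for x s
    unfolding 0 using loop_power_bounds[of s] by (intro order_trans[OF R_le(2)] rate_mono[of 0 0]) auto
  show "R1 x s \<le> R1 x 1" for x s
    unfolding 1 using loop_power_bounds[of s] by (intro order_trans[OF R_le(1)] rate_mono[of _ _ 0 0]) auto
qed

section \<open>Restriction to the segment between the users\<close>

definition clip :: "real \<Rightarrow> real" where
  "clip x = max (- D / 2) (min (D / 2) x)"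

text \<open>Projecting a position onto the segment between the users increases the distance to
  neither of them.\<close>

lemma clip_gain: "h1 beta0 H D x \<le> h1 beta0 H D (clip x)" "h2 beta0 H D x \<le> h2 beta0 H D (clip x)"
proof -
  have "beta0 / (y\<^sup>2 + H\<^sup>2) \<le> beta0 / (y'\<^sup>2 + H\<^sup>2)" if "\<bar>y'\<bar> \<le> \<bar>y\<bar>" for y y'
    using that pos by (intro divide_left_mono add_right_mono mult_pos_pos add_nonneg_pos)
      (auto simp: abs_le_square_iff)
  moreover have "\<bar>clip x - - D / 2\<bar> \<le> \<bar>x - - D / 2\<bar>" "\<bar>clip x - D / 2\<bar> \<le> \<bar>x - D / 2\<bar>"
    using pos by (auto simp: clip_def max_def min_def)
  ultimately show "h1 beta0 H D x \<le> h1 beta0 H D (clip x)" "h2 beta0 H D x \<le> h2 beta0 H D (clip x)"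
    unfolding h1_def h2_def chan_gain_def by blast+
qed

text \<open>
  The left-hand sides are w r1 + (1 - w) r2 at the pentagon corner favoured by w, written as a
  nonnegative combination of the constraints, so that they also bound integrated rates.
\<close>

lemma corner_le_best:
  assumes w: "w \<in> {0..1}" and p: "p \<ge> 0" "q \<ge> 0" "p + q \<le> P"
  shows "w \<ge> 1/2 \<Longrightarrow> (2 * w - 1) * rate1 x p + (1 - w) * rate12 x p q \<le> best w (clip x)"
    and "w \<le> 1/2 \<Longrightarrow> (1 - 2 * w) * rate2 x q + w * rate12 x p q \<le> best w (clip x)"
proof -
  have q: "q \<le> P - p" using p by simp
  have pP: "0 \<le> p / P" "p / P \<le> 1" using p pos by (auto simp: field_simps)
  \<comment> \<open>The loop passes power \<open>p\<close> twice: at \<open>p / P\<close>, at the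
    corner favouring user 1, and at \<open>2 - p / P\<close>, at the corner favouring user
    2.\<close>
  then have loop_power: "loop_power (p / P) = p" "loop_power (2 - p / P) = p" using pos by (auto simp: loop_power_def)
  note mono = rate_mono[OF p(1) order_refl p(2) q clip_gain]
  show "(2 * w - 1) * rate1 x p + (1 - w) * rate12 x p q \<le> best w (clip x)" if "w \<ge> 1/2"
  proof -
    have "(2 * w - 1) * rate1 x p + (1 - w) * rate12 x p q
        \<le> (2 * w - 1) * rate1 (clip x) p + (1 - w) * rate12 (clip x) p (P - p)"
      using w that by (intro add_mono mult_left_mono mono) auto
    also have "\<dots> = obj w (clip x) (p / P)"
      using pP by (simp add: obj_def R1_def R2_def loop_power algebra_simps)
    also have "\<dots> \<le> best w (clip x)" using pP by (intro best_upper) auto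
    finally show ?thesis .
  qed
  show "(1 - 2 * w) * rate2 x q + w * rate12 x p q \<le> best w (clip x)" if "w \<le> 1/2"
  proof -
    have "(1 - 2 * w) * rate2 x q + w * rate12 x p q
        \<le> (1 - 2 * w) * rate2 (clip x) (P - p) + w * rate12 (clip x) p (P - p)"
      using w that by (intro add_mono mult_left_mono mono) auto
    \<comment> \<open>If \<open>p = P\<close>, the parameter \<open>2 - p / P\<close> is 1 and falls
      into the other branch of \<open>R1\<close> and \<open>R2\<close>; the values agree since user
      2 has no power.\<close>
    also have "\<dots> \<le> obj w (clip x) (2 - p / P)"
    proof (cases "p = P")
      case True
      then show ?thesis using pos
        by (simp add: obj_def R1_def R2_def loop_power rate1_def rate2_def rate12_def algebra_simps)
    next
      case False
      then have "p / P < 1" using p pos by (auto simp: field_simps)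
      then show ?thesis by (simp add: obj_def R1_def R2_def loop_power algebra_simps)
    qed
    also have "\<dots> \<le> best w (clip x)" using pP by (intro best_upper) auto
    finally show ?thesis .
  qed
qed

lemma clip_bounds: "clip x \<in> {- D / 2..D / 2}"
  using pos by (auto simp: clip_def)

text \<open>The sum rate dominates both single rates and is at most twice \<open>best (1/2)\<close>
  at the clipped position, which ranges over a compact segment. The bound is therefore uniform in
  the position.\<close>

lemma rates_bounded:
  obtains B where "\<And>x p q. p \<ge> 0 \<Longrightarrow> q \<ge> 0 \<Longrightarrow> p + q \<le> P \<Longrightarrow>
    \<bar>rate1 x p\<bar> \<le> B \<and> \<bar>rate2 x q\<bar> \<le> B \<and> \<bar>rate12 x p q\<bar> \<le> B"
proof -
  have "\<exists>z\<in>{- D / 2..D / 2}. \<forall>y\<in>{- D / 2..D / 2}. best (1/2) y \<le> best (1/2) z"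
    by (intro continuous_attains_sup continuous_on_subset[OF best_cont]) (use pos in auto)
  then obtain z where z: "\<And>y. y \<in> {- D / 2..D / 2} \<Longrightarrow> best (1/2) y \<le> best (1/2) z"
    by blast
  show ?thesis
  proof (rule that[of "2 * best (1/2) z"])
    fix x p q :: real assume pq: "p \<ge> 0" "q \<ge> 0" "p + q \<le> P"
    have "rate12 x p q \<le> 2 * best (1/2) (clip x)"
      using corner_le_best(1)[OF _ pq, of "1/2" x] by simp
    with z[OF clip_bounds[of x]] rate_nonneg[OF pq(1,2), of x]
    show "\<bar>rate1 x p\<bar> \<le> 2 * best (1/2) z \<and> \<bar>rate2 x q\<bar> \<le> 2 * best (1/2) z \<and> \<bar>rate12 x p q\<bar> \<le> 2 * best (1/2) z"
      by auto
  qed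
qed

section \<open>Feasible points and their weighted rates\<close>

lemma rates_integrable:
  fixes x p1 p2 :: "real \<Rightarrow> real"
  assumes x: "continuous_on {0..T} x"
    and p: "p1 \<in> borel_measurable (restrict_space lborel {0..T})" "p2 \<in> borel_measurable (restrict_space lborel {0..T})"
      "\<And>t. t \<in> {0..T} \<Longrightarrow> p1 t \<ge> 0 \<and> p2 t \<ge> 0 \<and> p1 t + p2 t \<le> P"
  shows "set_integrable lborel {0..T} (\<lambda>t. rate1 (x t) (p1 t))"
    "set_integrable lborel {0..T} (\<lambda>t. rate2 (x t) (p2 t))"
    "set_integrable lborel {0..T} (\<lambda>t. rate12 (x t) (p1 t) (p2 t))"
proof -
  let ?M = "restrict_space lborel {0..T}"
  obtain B where B: "\<And>x p q. p \<ge> 0 \<Longrightarrow> q \<ge> 0 \<Longrightarrow> p + q \<le> P \<Longrightarrow>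
    \<bar>rate1 x p\<bar> \<le> B \<and> \<bar>rate2 x q\<bar> \<le> B \<and> \<bar>rate12 x p q\<bar> \<le> B"
    using rates_bounded by blast
  have [measurable]: "p1 \<in> borel_measurable ?M" "p2 \<in> borel_measurable ?M" by (rule p)+
  have "sets ?M = sets (restrict_space borel {0..T})"
    by (rule sets_restrict_space_cong) simp
  then have M: "measurable ?M borel = measurable (restrict_space borel {0..T}) borel"
    by (rule measurable_cong_sets) simp
  have gain: "(\<lambda>t. h1 beta0 H D (x t)) \<in> borel_measurable ?M" "(\<lambda>t. h2 beta0 H D (x t)) \<in> borel_measurable ?M"
    unfolding M by (intro borel_measurable_continuous_on_restrict continuous_intros x)+
  note [measurable] = gain
  have bound: "\<bar>rate1 (x t) (p1 t)\<bar> \<le> B" "\<bar>rate2 (x t) (p2 t)\<bar> \<le> B" "\<bar>rate12 (x t) (p1 t) (p2 t)\<bar> \<le> B"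
    if "t \<in> {0..T}" for t using B p(3)[OF that] by blast+
  have "(\<lambda>t. rate1 (x t) (p1 t)) \<in> borel_measurable ?M"
    "(\<lambda>t. rate2 (x t) (p2 t)) \<in> borel_measurable ?M"
    "(\<lambda>t. rate12 (x t) (p1 t) (p2 t)) \<in> borel_measurable ?M"
    unfolding rate1_def rate2_def rate12_def by measurable
  then show "set_integrable lborel {0..T} (\<lambda>t. rate1 (x t) (p1 t))"
    "set_integrable lborel {0..T} (\<lambda>t. rate2 (x t) (p2 t))"
    "set_integrable lborel {0..T} (\<lambda>t. rate12 (x t) (p1 t) (p2 t))"
    using set_integrable_bounded_restrict bound by blast+
qed

lemma P1_feasible_lipschitz:
  assumes "P1_feasible beta0 H D P T V a1 a2 r r1 r2 x p1 p2" "V > 0"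
  shows "V-lipschitz_on {0..T} x" "V-lipschitz_on {0..T} (\<lambda>t. clip (x t))"
proof -
  have x: "\<bar>x s - x t\<bar> \<le> V * \<bar>s - t\<bar>" if "s \<in> {0..T}" "t \<in> {0..T}" for s t
    using assms that unfolding P1_feasible_def by blast
  then show "V-lipschitz_on {0..T} x"
    using assms(2) by (intro lipschitz_onI) (auto simp: dist_real_def)
  have clip: "\<bar>clip y - clip y'\<bar> \<le> \<bar>y - y'\<bar>" for y y' by (auto simp: clip_def max_def min_def)
  then show "V-lipschitz_on {0..T} (\<lambda>t. clip (x t))"
    using assms(2) order_trans[OF clip x] by (intro lipschitz_onI) (auto simp: dist_real_def)
qed

text \<open>The weighted rate is a nonnegative combination of the sum-rate constraint and the
  constraint of the user with the larger weight. Under the integral, that combination is bounded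
  pointwise by \<open>best w\<close>.\<close>

lemma P1_feasible_dual_bound:
  assumes feas: "P1_feasible beta0 H D P T V a1 a2 r r1 r2 x p1 p2"
    and T: "T > 0" and V: "V > 0" and w: "w \<in> {0..1}"
  shows "r * T * (w * a1 + (1 - w) * a2) \<le> integral {0..T} (\<lambda>t. best w (clip (x t)))"
proof -
  define S1 where "S1 = set_lebesgue_integral lborel {0..T} (\<lambda>t. rate1 (x t) (p1 t))"
  define S2 where "S2 = set_lebesgue_integral lborel {0..T} (\<lambda>t. rate2 (x t) (p2 t))"
  define S12 where "S12 = set_lebesgue_integral lborel {0..T} (\<lambda>t. rate12 (x t) (p1 t) (p2 t))"
  have "r1 \<le> 1 / T * S1" "r2 \<le> 1 / T * S2" "r1 + r2 \<le> 1 / T * S12"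
    and r: "a1 * r \<le> r1" "a2 * r \<le> r2"
    and p: "p1 \<in> borel_measurable (restrict_space lborel {0..T})" "p2 \<in> borel_measurable (restrict_space lborel {0..T})"
      "\<And>t. t \<in> {0..T} \<Longrightarrow> p1 t \<ge> 0 \<and> p2 t \<ge> 0 \<and> p1 t + p2 t \<le> P"
    using feas unfolding P1_feasible_def rate_region_def S1_def S2_def S12_def rate1_def rate2_def rate12_def
    by auto
  then have S: "T * r1 \<le> S1" "T * r2 \<le> S2" "T * (r1 + r2) \<le> S12"
    using T by (simp_all add: field_simps)
  note xc = lipschitz_on_continuous_on[OF P1_feasible_lipschitz(1)[OF feas V]]
  note int = rates_integrable[OF xc p]
  have bi: "set_integrable lborel {0..T} (\<lambda>t. best w (clip (x t)))"
    by (intro borel_integrable_atLeastAtMost' continuous_on_compose2[OF best_cont]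
        lipschitz_on_continuous_on[OF P1_feasible_lipschitz(2)[OF feas V]]) auto
  have "r * T * (w * a1 + (1 - w) * a2) = T * (w * (a1 * r) + (1 - w) * (a2 * r))"
    by (simp add: algebra_simps)
  also have "\<dots> \<le> T * (w * r1 + (1 - w) * r2)"
    using w r T by (intro mult_left_mono add_mono) auto
  also have "\<dots> \<le> set_lebesgue_integral lborel {0..T} (\<lambda>t. best w (clip (x t)))"
  proof (cases "w \<ge> 1/2")
    case True
    have "T * (w * r1 + (1 - w) * r2) = (2 * w - 1) * (T * r1) + (1 - w) * (T * (r1 + r2))"
      by (simp add: algebra_simps)
    also have "\<dots> \<le> (2 * w - 1) * S1 + (1 - w) * S12"
      using w True S by (intro add_mono mult_left_mono) auto
    also have "\<dots> = set_lebesgue_integral lborel {0..T}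
        (\<lambda>t. (2 * w - 1) * rate1 (x t) (p1 t) + (1 - w) * rate12 (x t) (p1 t) (p2 t))"
      unfolding S1_def S12_def using int by (simp add: set_integral_add)
    also have "\<dots> \<le> set_lebesgue_integral lborel {0..T} (\<lambda>t. best w (clip (x t)))"
      using int bi p(3) corner_le_best(1)[OF w] True by (intro set_integral_mono) auto
    finally show ?thesis .
  next
    case False
    have "T * (w * r1 + (1 - w) * r2) = (1 - 2 * w) * (T * r2) + w * (T * (r1 + r2))"
      by (simp add: algebra_simps)
    also have "\<dots> \<le> (1 - 2 * w) * S2 + w * S12"
      using w False S by (intro add_mono mult_left_mono) auto
    also have "\<dots> = set_lebesgue_integral lborel {0..T}
        (\<lambda>t. (1 - 2 * w) * rate2 (x t) (p2 t) + w * rate12 (x t) (p1 t) (p2 t))"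
      unfolding S2_def S12_def using int by (simp add: set_integral_add)
    also have "\<dots> \<le> set_lebesgue_integral lborel {0..T} (\<lambda>t. best w (clip (x t)))"
      using int bi p(3) corner_le_best(2)[OF w] False by (intro set_integral_mono) auto
    finally show ?thesis .
  qed
  also have "\<dots> = integral {0..T} (\<lambda>t. best w (clip (x t)))"
    by (rule set_borel_integral_eq_integral(2)[OF bi])
  finally show ?thesis .
qed

text \<open>At each time the loop point satisfies both single-rate bounds and meets the sum-rate
  bound with equality. Integration turns this into the three constraints of the rate region.\<close>

lemma P1_feasible_of_loop:
  assumes T: "T > 0" and V: "V > 0" and r: "r \<ge> 0" and a: "a1 \<ge> 0" "a2 \<ge> 0"
    and x: "continuous_on UNIV x" "\<And>s t. \<bar>x s - x t\<bar> \<le> V * \<bar>s - t\<bar>"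
    and Y: "Y \<in> borel_measurable borel" "\<And>t. Y t \<in> {0..2}"
    and le: "a1 * r * T \<le> integral {0..T} (\<lambda>t. R1 (x t) (Y t))"
      "a2 * r * T \<le> integral {0..T} (\<lambda>t. R2 (x t) (Y t))"
  shows "P1_feasible beta0 H D P T V a1 a2 r (a1 * r) (a2 * r) x (\<lambda>t. loop_power (Y t)) (\<lambda>t. P - loop_power (Y t))"
proof -
  obtain B where B: "\<And>x p q. p \<ge> 0 \<Longrightarrow> q \<ge> 0 \<Longrightarrow> p + q \<le> P \<Longrightarrow>
    \<bar>rate1 x p\<bar> \<le> B \<and> \<bar>rate2 x q\<bar> \<le> B \<and> \<bar>rate12 x p q\<bar> \<le> B"
    using rates_bounded by blast
  have R_B: "\<bar>R1 x s\<bar> \<le> B" "\<bar>R2 x s\<bar> \<le> B" for x s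
    using B[of "loop_power s" "P - loop_power s" x] loop_power_bounds[of s] R_le[of x s] rate_nonneg[of "loop_power s" "P - loop_power s" x]
    by (auto simp: R1_def R2_def)
  have xm: "x \<in> borel_measurable borel" by (rule borel_measurable_continuous_onI[OF x(1)])
  note [measurable] = Y(1)
  have Rm: "(\<lambda>t. R1 (x t) (Y t)) \<in> borel_measurable borel" "(\<lambda>t. R2 (x t) (Y t)) \<in> borel_measurable borel"
    using R_cont by (auto simp: case_prod_unfold intro: borel_measurable_continuous_Pair[OF xm Y(1)])
  note i1 = bounded_borel_integral[where a=0 and b=T, OF Rm(1) R_B(1)]
  note i2 = bounded_borel_integral[where a=0 and b=T, OF Rm(2) R_B(2)]
  have loop_power_meas: "(\<lambda>t. loop_power (Y t)) \<in> borel_measurable borel"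
    unfolding loop_power_def by measurable
  have p: "(\<lambda>t. loop_power (Y t)) \<in> borel_measurable (restrict_space lborel {0..T})"
    "(\<lambda>t. P - loop_power (Y t)) \<in> borel_measurable (restrict_space lborel {0..T})"
    using loop_power_meas by (auto intro!: measurable_restrict_space1 borel_measurable_diff)
  have pb: "loop_power (Y t) \<ge> 0 \<and> P - loop_power (Y t) \<ge> 0 \<and> loop_power (Y t) + (P - loop_power (Y t)) \<le> P" for t
    using loop_power_bounds by simp
  note int = rates_integrable[OF continuous_on_subset[OF x(1) subset_UNIV] p pb]
  have 1: "a1 * r * T \<le> set_lebesgue_integral lborel {0..T} (\<lambda>t. rate1 (x t) (loop_power (Y t)))"
    by (rule order_trans[OF le(1)[folded i1(3)]]) (rule set_integral_mono[OF i1(1) int(1) R_le(1)])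
  have 2: "a2 * r * T \<le> set_lebesgue_integral lborel {0..T} (\<lambda>t. rate2 (x t) (P - loop_power (Y t)))"
    by (rule order_trans[OF le(2)[folded i2(3)]]) (rule set_integral_mono[OF i2(1) int(2) R_le(2)])
  have "a1 * r * T + a2 * r * T \<le> set_lebesgue_integral lborel {0..T} (\<lambda>t. R1 (x t) (Y t) + R2 (x t) (Y t))"
    using le[folded i1(3) i2(3)] set_integral_add(2)[OF i1(1) i2(1)] by simp
  then have 3: "a1 * r * T + a2 * r * T
      \<le> set_lebesgue_integral lborel {0..T} (\<lambda>t. rate12 (x t) (loop_power (Y t)) (P - loop_power (Y t)))"
    unfolding R_sum .
  have "(a1 * r, a2 * r) \<in> rate_region beta0 H D T x (\<lambda>t. loop_power (Y t)) (\<lambda>t. P - loop_power (Y t))"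
    unfolding rate_region_def rate1_def[symmetric] rate2_def[symmetric] rate12_def[symmetric]
    using 1 2 3 T a r by (simp add: field_simps)
  then show ?thesis
    unfolding P1_feasible_def using p pb x(2) by blast
qed

text \<open>The largest \<open>r\<close> satisfying the weighted inequalities for some interval is
  attained by a hover-fly-hover trajectory. The value of every feasible point satisfies them for the
  range of its clipped trajectory, so it cannot be larger.\<close>

lemma hfh_optimal:
  assumes T: "T > 0" and V: "V > 0" and a: "a1 \<ge> 0" "a2 \<ge> 0" "a1 + a2 = 1"
  shows "\<exists>xI xF tI tF r r1 r2 p1 p2.
           - D / 2 \<le> xI \<and> xI \<le> xF \<and> xF \<le> D / 2 \<and>
           tI \<ge> 0 \<and> tF \<ge> 0 \<and> tI + (xF - xI) / V + tF = T \<and>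
           P1_optimal beta0 H D P T V a1 a2 r r1 r2 (hfh_traj T V xI xF tI tF) p1 p2"
proof -
  have "- D / 2 \<le> D / 2" using pos by simp
  then obtain a b r
    where ab: "- D / 2 \<le> a" "a \<le> b" "b \<le> D / 2" "b - a \<le> V * T" "0 \<le> r" "dual_bound T V a1 a2 a b r"
    and largest: "\<And>a' b' r'. - D / 2 \<le> a' \<Longrightarrow> a' \<le> b' \<Longrightarrow> b' \<le> D / 2 \<Longrightarrow> b' - a' \<le> V * T \<Longrightarrow>
      dual_bound T V a1 a2 a' b' r' \<Longrightarrow> r' \<le> r"
    by (rule exists_largest_dual_bound[OF _ V T a]) (rule that; assumption)
  obtain xI xF tI tF Y where hfh: "a \<le> xI" "xI \<le> xF" "xF \<le> b" "tI \<ge> 0" "tF \<ge> 0"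
    "tI + (xF - xI) / V + tF = T" and Y: "Y \<in> borel_measurable borel" "\<And>t. Y t \<in> {0..2}"
    "a1 * r * T \<le> integral {0..T} (\<lambda>t. R1 (hfh_traj T V xI xF tI tF t) (Y t))"
    "a2 * r * T \<le> integral {0..T} (\<lambda>t. R2 (hfh_traj T V xI xF tI tF t) (Y t))"
    by (rule hfh_attains[OF V T ab(2,4) a ab(6)]) (rule that; assumption)
  note eq = hfh_traj_eq_long_traj[OF V hfh(2,6)]
  have "P1_feasible beta0 H D P T V a1 a2 r (a1 * r) (a2 * r) (hfh_traj T V xI xF tI tF)
      (\<lambda>t. loop_power (Y t)) (\<lambda>t. P - loop_power (Y t))"
    by (rule P1_feasible_of_loop[OF T V ab(5) a(1,2) _ _ Y])
       (auto simp: eq long_traj_lipschitz[OF V] intro: long_traj_continuous)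
  moreover have "r' \<le> r" if feas: "P1_feasible beta0 H D P T V a1 a2 r' r1' r2' x p1 p2" for r' r1' r2' x p1 p2
  proof -
    have range: "(\<lambda>t. clip (x t)) ` {0..T} \<subseteq> {- D / 2..D / 2}" using clip_bounds by auto
    obtain a' b' where "- D / 2 \<le> a'" "a' \<le> b'" "b' \<le> D / 2" "b' - a' \<le> V * T" "dual_bound T V a1 a2 a' b' r'"
      by (rule dual_bound_of_trajectory[OF V T P1_feasible_lipschitz(2)[OF feas V] range P1_feasible_dual_bound[OF feas T V]])
         (assumption | rule that)+
    then show ?thesis by (rule largest)
  qed
  ultimately have "P1_optimal beta0 H D P T V a1 a2 r (a1 * r) (a2 * r) (hfh_traj T V xI xF tI tF)
      (\<lambda>t. loop_power (Y t)) (\<lambda>t. P - loop_power (Y t))"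
    unfolding P1_optimal_def by blast
  moreover have "- D / 2 \<le> xI" "xF \<le> D / 2" using ab hfh by auto
  ultimately show ?thesis using hfh by blast
qed

end

theorem theorem2:
  fixes D H beta0 Pbar T V a1 a2 :: real
  assumes "D > 0" and "H > 0" and "beta0 > 0" and "Pbar > 0"
    and "T > 0" and "V > 0"
    and "a1 \<ge> 0" and "a2 \<ge> 0" and "a1 + a2 = 1"
  shows "\<exists>xI xF tI tF r r1 r2 p1 p2.
           - D / 2 \<le> xI \<and> xI \<le> xF \<and> xF \<le> D / 2 \<and>
           tI \<ge> 0 \<and> tF \<ge> 0 \<and> tI + (xF - xI) / V + tF = T \<and>
           P1_optimal beta0 H D Pbar T V a1 a2 r r1 r2
             (hfh_traj T V xI xF tI tF) p1 p2"
proof -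
  interpret two_user_channel beta0 H D Pbar
    by unfold_locales (use assms in auto)
  show ?thesis by (rule hfh_optimal) (use assms in auto)
qed

end
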